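(* Let $p$ be a prime, let $A\subseteq \mathbb{Z}/p\mathbb{Z}$ be a nonempty subset, and write $|2A|=2|A|+r$. Let $\alpha\approx 0.136861$ be the unique real root of the cubic $4x^3+9x^2+6x-1$. Suppose that $$|2A|\leq (2+\alpha)|A|-3\qquad\text{and}\qquad |2A|\leq \tfrac34 p.$$ Then there exist arithmetic progressions $P_A,P_{2A}\subseteq \mathbb{Z}/p\mathbb{Z}$ with the same common difference such that $A\subseteq P_A$, $|P_A|\leq |A|+r+1$, $P_{2A}\subseteq 2A$, and $|P_{2A}|\geq 2|A|-1$.
   Context: For $A\subseteq \mathbb{Z}/p\mathbb{Z}$, $2A=A+A=\{x+y: x,y\in A\}$. An arithmetic progression in $\mathbb{Z}/p\mathbb{Z}$ with difference $g\neq 0$ is a set of the form $\{a, a+g, a+2g,\dots,a+(k-1)g\}$ with $1\le k\le p$. *)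

theory Defs
  imports Complex_Main "HOL-Computational_Algebra.Primes"
begin

text \<open>Z/pZ is represented by the residues {0..<p} of type nat; addition is mod p.\<close>

definition sumset_mod :: "nat \<Rightarrow> nat set \<Rightarrow> nat set" where
  "sumset_mod p A = {(x + y) mod p | x y. x \<in> A \<and> y \<in> A}"

definition ap_mod :: "nat \<Rightarrow> nat \<Rightarrow> nat \<Rightarrow> nat \<Rightarrow> nat set" where
  "ap_mod p a g k = {(a + i * g) mod p | i. i < k}"

definition is_ap_mod :: "nat \<Rightarrow> nat \<Rightarrow> nat set \<Rightarrow> bool" where
  "is_ap_mod p g P \<longleftrightarrow> g mod p \<noteq> 0 \<and>
     (\<exists>a k. a < p \<and> 1 \<le> k \<and> k \<le> p \<and> P = ap_mod p a g k)"

end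

theory Submission
  imports Defs "HOL-Analysis.Analysis" "HOL-Library.Set_Algebras" "HOL-Number_Theory.Cong"
begin

text \<open>If \<open>A\<close> has small sumset then some nontrivial Fourier coefficient of \<open>A\<close> is large, so a dilate of \<open>A\<close> has
  a big portion inside half of the cycle. There the sum behaves as in the integers, and \<open>\<alpha>\<close> is exactly the
  threshold below which that portion satisfies Freiman's \<open>3k - 4\<close> condition. After a further dilation the
  portion is a dense subset of an interval and its sumset contains a long interval. The complement \<open>C\<close> of \<open>A + A\<close> is then
  confined to a short interval, and applying the long-interval theorem for two sets to \<open>C\<close> and the negated portion
  confines all of \<open>A\<close> to less than half of the cycle. One more use of Freiman's theorem gives the progressions.

  The integer theorem is reduced to \<open>\<int>/l\<int>\<close>, where \<open>l\<close> is the diameter of the set. Kneser's theorem is replaced by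
  Hamidoune's atoms: an extremal set for the growth of \<open>X \<mapsto> X + A\<close> is a subgroup \<open>H\<close>, the set \<open>A\<close> almost fills the
  cosets of \<open>H\<close> that it meets, and counting \<open>A + A\<close> coset by coset finishes the argument.\<close>

section \<open>Sumsets of dense sets of integers\<close>

declare set_plus_intro [rule del]

text \<open>Write n = |A| and s = |2A|. If no half circle of a nontrivial dilate held (s + 4) / 3
  points of A, all nontrivial Fourier coefficients would be at most M = (1 + 2 \<alpha>) n / 3.
  Parseval and Cauchy-Schwarz would then give (5 + 4 \<alpha>) n (p - s) \<le> (p - n) s, provided
  that (5 + 4 \<alpha>) M^2 = n^2. This proviso is the cubic, and with s + 3 \<le> (2 + \<alpha>) n
  the inequality contradicts s \<le> 3 p / 4. The obstacle is that a large coefficient says nothing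
  about the points outside the half circle. Confinement recovers them: it places A in a window of
  length s - n1, where n1 > s / 3 is the size of the good portion, and s \<le> 3 p / 4 keeps twice
  that length below p. Because confinement adds two different sets, the interval theorem is stated
  for two summands.\<close>

lemma card_sumset_ge:
  fixes A B :: "int set"
  assumes "finite A" "finite B" "A \<noteq> {}" "B \<noteq> {}"
  shows "card A + card B \<le> card (A + B) + 1"
proof -
  let ?L = "(\<lambda>a. a + Min B) ` A" and ?R = "(\<lambda>b. Max A + b) ` B"
  have "?L \<inter> ?R \<subseteq> {Max A + Min B}"
  proof
    fix z assume "z \<in> ?L \<inter> ?R"
    then obtain a b where ab: "a \<in> A" "b \<in> B" "z = a + Min B" "z = Max A + b" by auto
    moreover have "a \<le> Max A" "Min B \<le> b" using ab assms by auto
    ultimately show "z \<in> {Max A + Min B}" by auto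
  qed
  then have "card (?L \<inter> ?R) \<le> 1"
    using card_mono[of "{Max A + Min B}"] by fastforce
  moreover have "card (?L \<union> ?R) \<le> card (A + B)"
  proof (rule card_mono)
    show "finite (A + B)" using assms by (simp add: finite_set_plus)
    show "?L \<union> ?R \<subseteq> A + B" using assms by (auto intro!: set_plus_intro Min_in Max_in)
  qed
  moreover have "card ?L = card A" "card ?R = card B" by (auto intro!: card_image inj_onI)
  moreover have "card (?L \<union> ?R) + card (?L \<inter> ?R) = card ?L + card ?R"
    using card_Un_Int[of ?L ?R] assms by auto
  ultimately show ?thesis by linarith
qed

text \<open>A missing sum \<open>x\<close> makes \<open>A\<close> disjoint from the reflection x -
  B, so the two share every window. The case \<open>u = v + 1\<close> is an empty window; it serves
  the missing sums -1 and 2 l + 1 just outside the range.\<close>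

lemma card_windows_of_missing_sum:
  fixes A B :: "int set"
  assumes "x \<notin> A + B" "u \<le> v + 1"
  shows "int (card (A \<inter> {u..v})) + int (card (B \<inter> {x-v..x-u})) \<le> v - u + 1"
proof -
  let ?R = "(\<lambda>b. x - b) ` (B \<inter> {x-v..x-u})"
  have "card ?R = card (B \<inter> {x-v..x-u})" by (auto intro!: card_image inj_onI)
  moreover have "(A \<inter> {u..v}) \<inter> ?R = {}"
  proof -
    have "x - b \<notin> A" if "b \<in> B" for b using assms(1) set_plus_intro[of "x - b" A b B] that by auto
    then show ?thesis by auto
  qed
  then have "card (A \<inter> {u..v} \<union> ?R) = card (A \<inter> {u..v}) + card ?R"
    by (intro card_Un_disjoint) auto
  moreover have "card (A \<inter> {u..v} \<union> ?R) \<le> card {u..v}" by (rule card_mono) auto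
  ultimately show ?thesis using assms(2) by auto
qed

lemma finite_int_window: "finite {z \<in> {a..<b::int}. P z}"
  by (rule finite_subset[of _ "{a..<b}"]) auto

text \<open>Folding modulo \<open>l\<close>: a class hit by both \<open>z\<close> and
  \<open>z + l\<close> counts twice. The point \<open>2 * l\<close> is a third representative of
  class 0 and is counted apart.\<close>

lemma card_fold_le:
  fixes S :: "int set"
  assumes "finite S" "0 \<le> l"
  shows "card {z \<in> {0..<l}. z \<in> S \<or> z + l \<in> S} + card {z \<in> {0..<l}. z \<in> S \<and> z + l \<in> S}
    + (if 2 * l \<in> S then 1 else 0) \<le> card S"
proof -
  let ?P = "{z \<in> {0..<l}. z \<in> S}" and ?Q = "{z \<in> {0..<l}. z + l \<in> S}"
  let ?T = "if 2 * l \<in> S then {2 * l} else {}"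
  have un: "?P \<union> ?Q = {z \<in> {0..<l}. z \<in> S \<or> z + l \<in> S}"
    and int: "?P \<inter> ?Q = {z \<in> {0..<l}. z \<in> S \<and> z + l \<in> S}" by auto
  have "card ?P + card ?Q = card {z \<in> {0..<l}. z \<in> S \<or> z + l \<in> S}
      + card {z \<in> {0..<l}. z \<in> S \<and> z + l \<in> S}"
    unfolding un[symmetric] int[symmetric] by (intro card_Un_Int finite_int_window)
  moreover have "card ((\<lambda>z. z + l) ` ?Q) = card ?Q" by (auto intro!: card_image inj_onI)
  moreover have "card (?P \<union> (\<lambda>z. z + l) ` ?Q \<union> ?T) = card (?P \<union> (\<lambda>z. z + l) ` ?Q) + card ?T"
    using assms(2) by (intro card_Un_disjoint finite_UnI finite_imageI finite_int_window) auto
  moreover have "card (?P \<union> (\<lambda>z. z + l) ` ?Q) = card ?P + card ((\<lambda>z. z + l) ` ?Q)"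
    by (intro card_Un_disjoint finite_imageI finite_int_window) auto
  moreover have "card (?P \<union> (\<lambda>z. z + l) ` ?Q \<union> ?T) \<le> card S"
    by (rule card_mono) (use assms in auto)
  moreover have "card ?T = (if 2 * l \<in> S then 1 else 0)" by auto
  ultimately show ?thesis by linarith
qed

text \<open>The reflections in \<open>x\<close> and in \<open>y + l\<close> map the windows
  \<open>{0..x}\<close> and \<open>{y..l}\<close> to themselves, so both sets together have at most
  x + 1 and l - y + 1 points there. The gap contributes at most y - x - 1 for each set.\<close>

lemma card_le_of_missing_disjoint:
  fixes A B :: "int set"
  assumes AB: "A \<subseteq> {0..l}" "B \<subseteq> {0..l}"
    and x: "x \<notin> A + B" "-1 \<le> x" and y: "y + l \<notin> A + B" "y \<le> l + 1" and xy: "x < y"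
  shows "int (card A) + int (card B) \<le> l + y - x"
proof -
  have split: "int (card X) \<le> card (X \<inter> {0..x}) + (y - x - 1) + card (X \<inter> {y..l})"
    if "X \<subseteq> {0..l}" for X :: "int set"
  proof -
    have "X \<subseteq> (X \<inter> {0..x}) \<union> {x<..<y} \<union> (X \<inter> {y..l})" using that by auto
    then have "card X \<le> card ((X \<inter> {0..x}) \<union> {x<..<y} \<union> (X \<inter> {y..l}))" by (intro card_mono) auto
    also have "\<dots> \<le> card (X \<inter> {0..x}) + card {x<..<y} + card (X \<inter> {y..l})"
      by (meson card_Un_le order_trans add_right_mono)
    finally show ?thesis using xy by simp
  qed
  show ?thesis using split[OF AB(1)] split[OF AB(2)]
      card_windows_of_missing_sum[OF x(1), of 0 x] card_windows_of_missing_sum[OF y(1), of y l] x(2) y(2)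
    by simp
qed

text \<open>The same two windows now overlap in \<open>{y..x}\<close>, whose points count twice. For
  \<open>x = y\<close> this says that a class modulo \<open>l\<close> missed by the sumset forces
  |A| + |B| \<le> l + 2.\<close>

lemma card_le_of_missing_overlap:
  fixes A B :: "int set"
  assumes AB: "A \<subseteq> {0..l}" "B \<subseteq> {0..l}"
    and x: "x \<notin> A + B" "x \<le> l" and y: "y + l \<notin> A + B" "0 \<le> y" and xy: "y \<le> x"
  shows "int (card A) + int (card B) + card (A \<inter> {y..x}) + card (B \<inter> {y..x}) \<le> l + (x - y) + 2"
proof -
  have split: "int (card (X \<inter> {0..x})) + card (X \<inter> {y..l}) = card X + card (X \<inter> {y..x})"
    if "X \<subseteq> {0..l}" for X :: "int set"
  proof -
    have "X = (X \<inter> {0..x}) \<union> (X \<inter> {y..l})" "X \<inter> {y..x} = (X \<inter> {0..x}) \<inter> (X \<inter> {y..l})"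
      using that x y xy by auto
    then show ?thesis using card_Un_Int[of "X \<inter> {0..x}" "X \<inter> {y..l}"] by auto
  qed
  show ?thesis using split[OF AB(1)] split[OF AB(2)]
      card_windows_of_missing_sum[OF x(1), of 0 x] card_windows_of_missing_sum[OF y(1), of y l] x(2) y(2) xy
    by simp
qed

text \<open>Density excludes a missed class, so the fold covers all \<open>l\<close> classes. As 0
  and \<open>l\<close> both lie in \<open>A\<close>, each element of \<open>B\<close> other than
  \<open>l\<close> yields a class hit twice.\<close>

lemma dense_sumset_fold:
  fixes A B :: "int set"
  assumes AB: "A \<subseteq> {0..l}" "B \<subseteq> {0..l}" "0 \<in> A" "l \<in> A"
    and dense: "l + 3 \<le> int (card A) + int (card B)"
  shows "l + card {z \<in> {0..<l}. z \<in> A + B \<and> z + l \<in> A + B} + (if l \<in> B then 1 else 0) \<le> int (card (A + B))"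
    and "B - {l} \<subseteq> {z \<in> {0..<l}. z \<in> A + B \<and> z + l \<in> A + B}"
proof -
  have l: "0 \<le> l" using AB by auto
  have fin: "finite (A + B)" using AB finite_set_plus finite_subset by blast
  have "z \<in> A + B \<or> z + l \<in> A + B" if "z \<in> {0..<l}" for z
  proof (rule ccontr)
    assume "\<not> ?thesis"
    then show False using card_le_of_missing_overlap[OF AB(1,2), of z z] that dense by auto
  qed
  then have all: "{z \<in> {0..<l}. z \<in> A + B \<or> z + l \<in> A + B} = {0..<l}" by blast
  have "l \<in> B \<Longrightarrow> 2 * l \<in> A + B" using set_plus_intro[OF AB(4), of l B] by simp
  moreover have "int (card {0..<l}) = l" using l by simp
  ultimately show "l + card {z \<in> {0..<l}. z \<in> A + B \<and> z + l \<in> A + B} + (if l \<in> B then 1 else 0) \<le> int (card (A + B))"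
    using card_fold_le[OF fin l] unfolding all
    by (cases "l \<in> B"; cases "2 * l \<in> A + B"; simp only: if_True if_False; linarith)
  show "B - {l} \<subseteq> {z \<in> {0..<l}. z \<in> A + B \<and> z + l \<in> A + B}"
  proof
    fix b assume "b \<in> B - {l}"
    then show "b \<in> {z \<in> {0..<l}. z \<in> A + B \<and> z + l \<in> A + B}"
      using AB(2) set_plus_intro[OF AB(3), of b B] set_plus_intro[OF AB(4), of b B]
      by (auto simp: add.commute)
  qed
qed

lemma card_dense_sumset_ge:
  fixes A B :: "int set"
  assumes "A \<subseteq> {0..l}" "B \<subseteq> {0..l}" "0 \<in> A" "l \<in> A"
    and "l + 3 \<le> int (card A) + int (card B)"
  shows "l + int (card B) \<le> int (card (A + B))"
proof -
  have "card (B - {l}) \<le> card {z \<in> {0..<l}. z \<in> A + B \<and> z + l \<in> A + B}"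
    by (rule card_mono[OF _ dense_sumset_fold(2)[OF assms]]) (rule finite_int_window)
  moreover have "card B = card (B - {l}) + (if l \<in> B then 1 else 0)"
    using assms(2) card_Suc_Diff1[of B l] finite_subset[of B] by auto
  ultimately show ?thesis using dense_sumset_fold(1)[OF assms]
    by (cases "l \<in> B"; simp only: if_True if_False; linarith)
qed

text \<open>Modulo \<open>l\<close> everything is covered, so the only obstruction is a pair \<open>y \<le> x\<close> with both \<open>x\<close> and \<open>y + l\<close>
  missing. For the closest such pair all points strictly between are covered twice modulo \<open>l\<close>, and by pigeonhole
  there are too many of them.\<close>

theorem dense_sumset_interval:
  fixes A B :: "int set"
  assumes AB: "A \<subseteq> {0..l}" "B \<subseteq> {0..l}" "0 \<in> A" "l \<in> A"
    and dense: "l + 3 \<le> int (card A) + int (card B)"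
    and small: "int (card (A + B)) \<le> int (card A) + 2 * int (card B) - 4"
  obtains u where "{u..<u + (int (card A) + int (card B) - 1)} \<subseteq> A + B"
proof -
  have l: "0 \<le> l" using AB by auto
  have bounds: "A + B \<subseteq> {0..2 * l}"
  proof
    fix z assume "z \<in> A + B"
    then obtain a b where "z = a + b" "a \<in> A" "b \<in> B" by (rule set_plus_elim)
    then show "z \<in> {0..2 * l}" using AB(1,2) by fastforce
  qed
  \<comment> \<open>The sentinels -1 and \<open>l + 1\<close> are missing because all sums lie in
    \<open>{0..2 * l}\<close>; they make \<open>Max L\<close> and \<open>Min R\<close> exist in
    every case.\<close>
  define L where "L = {x \<in> {-1..<l}. x \<notin> A + B}"
  define R where "R = {y \<in> {0..l+1}. y + l \<notin> A + B}"
  have "finite L" unfolding L_def by (rule finite_int_window)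
  moreover have "finite R" unfolding R_def by (rule finite_subset[of _ "{0..l+1}"]) auto
  moreover have "-1 \<in> L" "l + 1 \<in> R" using l bounds by (auto simp: L_def R_def)
  ultimately have LR: "finite L" "finite R" "-1 \<in> L" "l + 1 \<in> R" by auto
  have no_pair: "x < y" if "x \<in> L" "y \<in> R" for x y
  proof (rule ccontr)
    assume "\<not> x < y"
    define Z where "Z = {(x, y). x \<in> L \<and> y \<in> R \<and> y \<le> x}"
    have "(x, y) \<in> Z" using that \<open>\<not> x < y\<close> by (auto simp: Z_def)
    then obtain q where q: "q \<in> Z" "\<And>q'. q' \<in> Z \<Longrightarrow> nat (fst q - snd q) \<le> nat (fst q' - snd q')"
      using ex_has_least_nat[of "\<lambda>q. q \<in> Z" _ "\<lambda>q. nat (fst q - snd q)"] by blast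
    obtain x y where xy: "q = (x, y)" by force
    have x: "x \<in> L" and y: "y \<in> R" and le: "y \<le> x" using q(1) by (auto simp: Z_def xy)
    then have x': "0 \<le> x" "x < l" "x \<notin> A + B" and y': "0 \<le> y" "y < l" "y + l \<notin> A + B" by (auto simp: L_def R_def)
    have ineq: "int (card A) + int (card B) + card (A \<inter> {y..x}) + card (B \<inter> {y..x}) \<le> l + (x - y) + 2"
      using card_le_of_missing_overlap[OF AB(1,2)] x' y' le by auto
    let ?D = "{z \<in> {0..<l}. z \<in> A + B \<and> z + l \<in> A + B}"
    have "z \<in> ?D" if z: "z \<in> {y<..<x}" for z
    proof -
      have "z \<notin> L" using q(2)[of "(z, y)"] z y by (auto simp: Z_def xy)
      moreover have "z \<notin> R" using q(2)[of "(x, z)"] z x by (auto simp: Z_def xy)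
      ultimately show ?thesis using z x' y' by (auto simp: L_def R_def)
    qed
    then have sub: "(B - {l}) \<union> {y<..<x} \<subseteq> ?D" using dense_sumset_fold(2)[OF AB dense] by auto
    have finB: "finite B" using AB finite_subset by blast
    have "(B - {l}) \<inter> {y<..<x} \<subseteq> B \<inter> {y..x}" by auto
    then have "card ((B - {l}) \<inter> {y<..<x}) \<le> card (B \<inter> {y..x})" by (rule card_mono[rotated]) auto
    moreover have "card ((B - {l}) \<union> {y<..<x}) + card ((B - {l}) \<inter> {y<..<x}) = card (B - {l}) + card {y<..<x}"
      using card_Un_Int[of "B - {l}" "{y<..<x}"] finB by auto
    moreover have "card ((B - {l}) \<union> {y<..<x}) \<le> card ?D" using sub by (intro card_mono finite_int_window)
    moreover have "card B = card (B - {l}) + (if l \<in> B then 1 else 0)"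
      using finB card_Suc_Diff1[of B l] by auto
    moreover have "int (card {y<..<x}) \<ge> x - y - 1" by simp
    \<comment> \<open>At least |B - {l}| + (x - y - 1) - |B \<inter> {y..x}| classes are hit twice.
      Together with \<open>ineq\<close> this yields |A + B| \<ge> |A| + 2 |B| - 3, one more than
      \<open>small\<close> allows.\<close>
    ultimately show False using dense_sumset_fold(1)[OF AB dense] ineq small
      by (cases "l \<in> B"; simp only: if_True if_False; linarith)
  qed
  have max: "Max L \<in> L" "Min R \<in> R" using LR Max_in Min_in by blast+
  have "Max L < Min R" using no_pair max by auto
  then have len: "int (card A) + int (card B) \<le> l + Min R - Max L"
    using card_le_of_missing_disjoint[OF AB(1,2)] max by (auto simp: L_def R_def)
  have "z \<in> A + B" if "Max L < z" "z < l + Min R" for z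
  proof (cases "z < l")
    case True
    then have "z \<notin> L" using that(1) LR Max_ge by fastforce
    then show ?thesis using True that Max_ge[OF LR(1,3)] by (auto simp: L_def)
  next
    case False
    then have "z - l \<notin> R" using that(2) LR Min_le by fastforce
    then show ?thesis using False that max by (auto simp: R_def)
  qed
  then have "{Max L + 1..<Max L + 1 + (int (card A) + int (card B) - 1)} \<subseteq> A + B"
    using len by (intro subsetI) simp
  then show thesis using that by blast
qed

section \<open>Atoms in cyclic groups\<close>

definition msum :: "int \<Rightarrow> int set \<Rightarrow> int set \<Rightarrow> int set" where
  "msum m X Y = (\<lambda>z. z mod m) ` (X + Y)"

lemma msumI: "x \<in> X \<Longrightarrow> y \<in> Y \<Longrightarrow> (x + y) mod m \<in> msum m X Y"
  unfolding msum_def by (intro imageI set_plus_intro)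

lemma msumE:
  assumes "z \<in> msum m X Y"
  obtains x y where "x \<in> X" "y \<in> Y" "z = (x + y) mod m"
  using assms unfolding msum_def by (elim imageE set_plus_elim) blast

lemma msum_subset: "0 < m \<Longrightarrow> msum m X Y \<subseteq> {0..<m}"
  unfolding msum_def by (intro image_subsetI) simp

lemma finite_msum [simp]: "0 < m \<Longrightarrow> finite (msum m X Y)"
  by (rule finite_subset[OF msum_subset]) simp_all

lemma msum_mono: "X \<subseteq> X' \<Longrightarrow> Y \<subseteq> Y' \<Longrightarrow> msum m X Y \<subseteq> msum m X' Y'"
  unfolding msum_def by (intro image_mono set_plus_mono2)

lemma msum_Un: "msum m (X \<union> X') Y = msum m X Y \<union> msum m X' Y"
  unfolding msum_def by (simp add: Un_set_plus image_Un)

lemma inj_on_affine_mod: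
  fixes m t c :: int
  assumes "coprime t m"
  shows "inj_on (\<lambda>x. (t * x + c) mod m) {0..<m}"
proof (rule inj_onI)
  fix x y assume xy: "x \<in> {0..<m}" "y \<in> {0..<m}" "(t * x + c) mod m = (t * y + c) mod m"
  then have "m dvd (t * x + c) - (t * y + c)" by (simp add: mod_eq_dvd_iff)
  then have "m dvd t * (x - y)" by (simp add: algebra_simps)
  then have "m dvd x - y" using assms by (simp add: coprime_commute coprime_dvd_mult_right_iff)
  then show "x = y" using xy by (simp add: mod_eq_dvd_iff[symmetric])
qed

lemma card_affine_mod:
  fixes m t c :: int
  assumes "coprime t m" "X \<subseteq> {0..<m}"
  shows "card ((\<lambda>x. (t * x + c) mod m) ` X) = card X"
  using inj_on_affine_mod[OF assms(1)] assms(2) by (meson card_image inj_on_subset)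

lemma msum_affine:
  fixes m t b c :: int
  shows "msum m ((\<lambda>x. (t * x + b) mod m) ` X) ((\<lambda>x. (t * x + c) mod m) ` Y)
    = (\<lambda>x. (t * x + (b + c)) mod m) ` msum m X Y"
proof -
  have eq: "((t * x + b) mod m + (t * y + c) mod m) mod m = (t * ((x + y) mod m) + (b + c)) mod m" for x y
  proof -
    have "(t * ((x + y) mod m) + (b + c)) mod m = (t * (x + y) + (b + c)) mod m"
      by (metis mod_add_left_eq mod_mult_right_eq)
    then show ?thesis by (simp add: mod_add_eq algebra_simps)
  qed
  show ?thesis (is "?L = ?R")
  proof (rule set_eqI, rule iffI)
    fix z assume "z \<in> ?L"
    then obtain x y where "x \<in> X" "y \<in> Y" "z = ((t * x + b) mod m + (t * y + c) mod m) mod m"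
      by (auto elim!: msumE)
    then show "z \<in> ?R" unfolding eq using msumI by blast
  next
    fix z assume "z \<in> ?R"
    then obtain x y where xy: "x \<in> X" "y \<in> Y" "z = (t * ((x + y) mod m) + (b + c)) mod m"
      by (auto elim!: msumE)
    show "z \<in> ?L" unfolding xy(3) eq[symmetric] using xy by (intro msumI imageI)
  qed
qed

lemma msum_translate:
  fixes m c :: int
  assumes "Y \<subseteq> {0..<m}"
  shows "msum m ((\<lambda>x. (x + c) mod m) ` X) Y = (\<lambda>x. (x + c) mod m) ` msum m X Y"
proof -
  have "(\<lambda>x. (1 * x + 0) mod m) ` Y = Y" using assms by (force simp: image_iff)
  then show ?thesis using msum_affine[of m 1 c X 0 Y] by simp
qed

text \<open>Hamidoune's atom argument: a smallest minimiser of \<open>|X + A| - |X|\<close> is, up to translation, a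
  subgroup, because two intersecting translates of it must coincide by submodularity. The case in which the union
  of the two translates has full sumset is excluded by passing to the negated complement of \<open>X + A\<close>,
  which is again a minimiser.\<close>

theorem atom_subgroup:
  fixes m :: int
  assumes m: "0 < m" and A: "A \<subseteq> {0..<m}"
    and X0: "X0 \<subseteq> {0..<m}" "X0 \<noteq> {}" "msum m X0 A \<noteq> {0..<m}"
  obtains H where "H \<subseteq> {0..<m}" "0 \<in> H" "\<And>x y. x \<in> H \<Longrightarrow> y \<in> H \<Longrightarrow> (x - y) mod m \<in> H"
    "msum m H A \<noteq> {0..<m}"
    "\<And>X. X \<subseteq> {0..<m} \<Longrightarrow> X \<noteq> {} \<Longrightarrow> msum m X A \<noteq> {0..<m} \<Longrightarrow>
      int (card (msum m H A)) - int (card H) \<le> int (card (msum m X A)) - int (card X)"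
proof -
  define G where "G = {0..<m}"
  define adm where "adm X \<longleftrightarrow> X \<subseteq> G \<and> X \<noteq> {} \<and> msum m X A \<noteq> G" for X
  define bd where "bd X = int (card (msum m X A)) - int (card X)" for X
  have finG: "finite G" and cG: "int (card G) = m" using m by (auto simp: G_def)
  have sub: "msum m X A \<subseteq> G" for X using msum_subset[OF m] by (simp add: G_def)
  have cX: "int (card X) \<le> m" if "X \<subseteq> G" for X using card_mono[OF finG that] cG by simp
  have "adm X0" using X0 by (simp add: adm_def G_def)
  \<comment> \<open>\<open>bd\<close> may be negative but is at least -m, so the shift by
    \<open>m\<close> turns the minimum into one over natural numbers.\<close>
  then obtain X1 where X1: "adm X1" "\<And>X. adm X \<Longrightarrow> nat (bd X1 + m) \<le> nat (bd X + m)"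
    using ex_has_least_nat[of adm X0 "\<lambda>X. nat (bd X + m)"] by blast
  define \<kappa> where "\<kappa> = bd X1"
  define fr where "fr X \<longleftrightarrow> adm X \<and> bd X = \<kappa>" for X
  have min: "\<kappa> \<le> bd X" if "adm X" for X
  proof -
    have "0 \<le> bd X + m" using cX[of X] that by (simp add: bd_def adm_def)
    then show ?thesis using X1(2)[OF that] by (simp add: \<kappa>_def)
  qed
  have "fr X1" using X1(1) by (simp add: fr_def \<kappa>_def)
  then obtain H0 where H0: "fr H0" "\<And>X. fr X \<Longrightarrow> card H0 \<le> card X"
    using ex_has_least_nat[of fr X1 card] by blast
  have H0': "H0 \<subseteq> G" "H0 \<noteq> {}" "msum m H0 A \<noteq> G" "bd H0 = \<kappa>" using H0(1) by (auto simp: fr_def adm_def)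
  have negneg: "(- ((- z) mod m)) mod m = z" if "z \<in> G" for z
    using that by (simp add: G_def mod_minus_eq)
  have neg_card: "card {z \<in> G. (- z) mod m \<in> S} = card S" if "S \<subseteq> G" for S
  proof -
    have "bij_betw (\<lambda>z. (- z) mod m) {z \<in> G. (- z) mod m \<in> S} S"
      by (rule bij_betw_byWitness[where f' = "\<lambda>z. (- z) mod m"])
        (use negneg that m in \<open>auto simp: G_def subset_iff\<close>)
    then show ?thesis by (rule bij_betw_same_card)
  qed
  \<comment> \<open>Duality: \<open>Y\<close> is the negated complement of H0 + A, and Y + A avoids
    -H0. Hence \<open>bd Y \<le> \<kappa>\<close>, so \<open>Y\<close> is a minimiser too, and |H0|
    \<le> |Y| = m - |H0| - \<kappa>.\<close>
  have size: "2 * int (card H0) + \<kappa> \<le> m"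
  proof -
    define Y where "Y = {z \<in> G. (- z) mod m \<in> G - msum m H0 A}"
    have cY: "int (card Y) = m - int (card (msum m H0 A))"
      unfolding Y_def using neg_card[of "G - msum m H0 A"] card_Diff_subset[OF _ sub[of H0]] cG
        card_mono[OF finG sub[of H0]] m by (simp add: of_nat_diff)
    have "card (msum m H0 A) < card G" using sub[of H0] H0'(3) finG by (simp add: psubset_card_mono psubsetI)
    then have "Y \<noteq> {}" using cY cG by auto
    have "msum m Y A \<inter> {z \<in> G. (- z) mod m \<in> H0} = {}"
    proof (rule equals0I)
      fix z assume z: "z \<in> msum m Y A \<inter> {z \<in> G. (- z) mod m \<in> H0}"
      then obtain y a where ya: "y \<in> Y" "a \<in> A" "z = (y + a) mod m" by (auto elim!: msumE)
      have "((- z) mod m + a) mod m \<in> msum m H0 A" using z ya by (intro msumI) auto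
      moreover have "((- z) mod m + a) mod m = (- y) mod m"
        unfolding ya(3) by (simp add: mod_simps)
      ultimately show False using ya(1) by (simp add: Y_def)
    qed
    then have disj: "msum m Y A \<subseteq> G - {z \<in> G. (- z) mod m \<in> H0}" using sub[of Y] by blast
    have "card (G - {z \<in> G. (- z) mod m \<in> H0}) = card G - card H0"
      using card_Diff_subset[of "{z \<in> G. (- z) mod m \<in> H0}" G] neg_card[OF H0'(1)] finG by simp
    then have cYA: "int (card (msum m Y A)) \<le> m - int (card H0)"
      using card_mono[OF _ disj] finG cG card_mono[OF finG H0'(1)] by simp
    have "0 < card H0" using H0'(1,2) finG finite_subset by (auto simp: card_gt_0_iff)
    then have "adm Y" using cYA cG \<open>Y \<noteq> {}\<close> by (auto simp: adm_def Y_def)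
    moreover have "bd Y \<le> \<kappa>" using cYA cY H0'(4) by (simp add: bd_def)
    ultimately have "fr Y" using min[of Y] by (simp add: fr_def)
    then show ?thesis using H0(2)[of Y] cY H0'(4) by (simp add: bd_def)
  qed
  have atom: "X = Y" if X: "fr X" "card X = card H0" and Y: "fr Y" "card Y = card H0" and XY: "X \<inter> Y \<noteq> {}" for X Y
  proof (rule ccontr)
    assume "X \<noteq> Y"
    have fin: "finite X" "finite Y" using X Y finG finite_subset by (auto simp: fr_def adm_def)
    have "X \<inter> Y \<noteq> X" using \<open>X \<noteq> Y\<close> X(2) Y(2) fin by (metis Int_lower2 card_subset_eq)
    then have less: "card (X \<inter> Y) < card H0" using X(2) fin by (metis Int_lower1 psubsetI psubset_card_mono)
    have "adm (X \<inter> Y)"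
      using X(1) XY msum_mono[of "X \<inter> Y" X A A m] sub[of X] by (auto simp: fr_def adm_def)
    then have big: "\<kappa> < bd (X \<inter> Y)" using min[of "X \<inter> Y"] H0(2)[of "X \<inter> Y"] less by (force simp: fr_def)
    have "card (msum m (X \<inter> Y) A) \<le> card (msum m X A \<inter> msum m Y A)"
      using m by (intro card_mono Int_greatest msum_mono) simp_all
    moreover have "card (msum m (X \<union> Y) A) + card (msum m X A \<inter> msum m Y A) = card (msum m X A) + card (msum m Y A)"
      unfolding msum_Un using card_Un_Int[of "msum m X A" "msum m Y A"] m by simp
    moreover have "card (X \<union> Y) + card (X \<inter> Y) = card X + card Y" using card_Un_Int fin by metis
    moreover have "bd X = \<kappa>" "bd Y = \<kappa>" using X Y by (auto simp: fr_def)
    \<comment> \<open>By submodularity the values of \<open>bd\<close> at the intersection and the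
      union add up to at most 2 \<kappa>. The intersection is too small to be a minimiser, hence
      strictly above \<kappa>, which pushes the union strictly below.\<close>
    ultimately have small: "bd (X \<union> Y) < \<kappa>" "int (card (msum m (X \<union> Y) A)) < \<kappa> + 2 * int (card H0) - int (card (X \<inter> Y))"
      using big X(2) Y(2) unfolding bd_def by linarith+
    then have "\<not> adm (X \<union> Y)" using min by force
    then have "msum m (X \<union> Y) A = G" using X(1) Y(1) by (auto simp: fr_def adm_def)
    then show False using small(2) size cG by simp
  qed
  have trans: "fr ((\<lambda>x. (x + t) mod m) ` X) \<and> card ((\<lambda>x. (x + t) mod m) ` X) = card X" if "fr X" for X t
  proof -
    have XG: "X \<subseteq> G" using that by (simp add: fr_def adm_def)
    have c: "card ((\<lambda>x. (x + t) mod m) ` S) = card S" if "S \<subseteq> G" for S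
      using card_affine_mod[of 1 m S t] that by (simp add: G_def)
    have "msum m ((\<lambda>x. (x + t) mod m) ` X) A = (\<lambda>x. (x + t) mod m) ` msum m X A"
      using A by (rule msum_translate)
    then have c2: "card (msum m ((\<lambda>x. (x + t) mod m) ` X) A) = card (msum m X A)" using c[OF sub[of X]] by simp
    have "card (msum m X A) < card G"
      using that sub[of X] finG by (auto simp: fr_def adm_def intro!: psubset_card_mono)
    then have "adm ((\<lambda>x. (x + t) mod m) ` X)" using that c2 m by (auto simp: fr_def adm_def G_def)
    then show ?thesis using that c2 c[OF XG] by (simp add: fr_def bd_def)
  qed
  obtain h0 where h0: "h0 \<in> H0" using H0'(2) by auto
  define H where "H = (\<lambda>x. (x + - h0) mod m) ` H0"
  have H: "fr H" "card H = card H0" using trans[OF H0(1), of "- h0"] by (auto simp: H_def)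
  have zero: "0 \<in> H" using h0 by (force simp: H_def image_iff)
  have closed: "(x - y) mod m \<in> H" if "x \<in> H" "y \<in> H" for x y
  proof -
    \<comment> \<open>This translate of \<open>H\<close> has the same size and is again a minimiser.
      It meets \<open>H\<close> in 0, so it equals \<open>H\<close>.\<close>
    let ?T = "(\<lambda>x. (x + - y) mod m) ` H"
    have "0 \<in> ?T" using that by (intro image_eqI[of _ _ y]) auto
    then have "H = ?T" using atom[OF H, of ?T] trans[OF H(1), of "- y"] zero H(2) by auto
    then show ?thesis using that by auto
  qed
  show thesis
  proof (rule that[OF _ zero closed])
    show "H \<subseteq> {0..<m}" "msum m H A \<noteq> {0..<m}" using H(1) by (auto simp: fr_def adm_def G_def)
    fix X assume "X \<subseteq> {0..<m}" "X \<noteq> {}" "msum m X A \<noteq> {0..<m}"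
    then have "adm X" by (simp add: adm_def G_def)
    then show "int (card (msum m H A)) - int (card H) \<le> int (card (msum m X A)) - int (card X)"
      using min H(1) by (force simp: fr_def bd_def)
  qed
qed

text \<open>The preimage \<open>K\<close> of \<open>H\<close> in the integers is closed under
  differences, hence consists of the multiples of its least positive element, which divides
  \<open>m\<close> because \<open>m\<close> lies in \<open>K\<close>.\<close>

lemma mod_subgroup_multiples:
  fixes m :: int
  assumes m: "0 < m" and H: "H \<subseteq> {0..<m}" "0 \<in> H" "\<And>x y. x \<in> H \<Longrightarrow> y \<in> H \<Longrightarrow> (x - y) mod m \<in> H"
  obtains d where "0 < d" "d dvd m" "H = {z \<in> {0..<m}. d dvd z}"
proof -
  define K where "K = {z. z mod m \<in> H}"
  have diff: "x - y \<in> K" if "x \<in> K" "y \<in> K" for x y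
    using H(3)[of "x mod m" "y mod m"] that by (simp add: K_def mod_diff_eq)
  have K0: "0 \<in> K" "m \<in> K" using H by (auto simp: K_def)
  have neg: "- y \<in> K" if "y \<in> K" for y using diff[OF K0(1) that] by simp
  have add: "x + y \<in> K" if "x \<in> K" "y \<in> K" for x y using diff[OF that(1) neg[OF that(2)]] by simp
  have mulnat: "int n * y \<in> K" if "y \<in> K" for n y
    by (induction n) (use K0 add that in \<open>auto simp: algebra_simps\<close>)
  have mul: "k * y \<in> K" if "y \<in> K" for k y
  proof (cases "0 \<le> k")
    case True then show ?thesis using mulnat[OF that, of "nat k"] by simp
  next
    case False then show ?thesis using neg[OF mulnat[OF that, of "nat (- k)"]] by simp
  qed
  have "\<exists>n::nat. 0 < n \<and> int n \<in> K" using K0 m by (intro exI[of _ "nat m"]) auto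
  then obtain n where n: "0 < n" "int n \<in> K" "\<And>n'. 0 < n' \<and> int n' \<in> K \<Longrightarrow> n \<le> n'"
    using ex_has_least_nat[of "\<lambda>n. 0 < n \<and> int n \<in> K" _ "\<lambda>n. n"] by blast
  have K: "z \<in> K \<longleftrightarrow> int n dvd z" for z
  proof
    assume "z \<in> K"
    then have "z - (z div int n) * int n \<in> K" using diff mul[OF n(2)] by blast
    then have "z mod int n \<in> K" by (simp add: minus_div_mult_eq_mod)
    moreover have "0 \<le> z mod int n" "z mod int n < int n" using n(1) by auto
    moreover have "int (nat (z mod int n)) = z mod int n" using n(1) by simp
    moreover from this have "int (nat (z mod int n)) \<in> K" using \<open>z mod int n \<in> K\<close> by (simp only:)
    ultimately have "\<not> 0 < nat (z mod int n)" using n(3)[of "nat (z mod int n)"] by linarith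
    then show "int n dvd z" using \<open>0 \<le> z mod int n\<close> by (simp add: dvd_eq_mod_eq_0)
  next
    assume "int n dvd z"
    then show "z \<in> K" using mul[OF n(2)] by (metis dvd_def mult.commute)
  qed
  show thesis
  proof (rule that)
    show "0 < int n" using n by simp
    show "int n dvd m" using K K0 by blast
    have "z \<in> H \<longleftrightarrow> z \<in> {0..<m} \<and> z \<in> K" for z using H(1) by (auto simp: K_def)
    then show "H = {z \<in> {0..<m}. int n dvd z}" using K by auto
  qed
qed

section \<open>Freiman's theorem in the integers\<close>

lemma card_residues_in:
  fixes d h :: int
  assumes d: "0 < d" and h: "0 \<le> h" and S: "S \<subseteq> {0..<d}"
  shows "int (card {z \<in> {0..<d * h}. z mod d \<in> S}) = int (card S) * h"
proof -
  have "{z \<in> {0..<d * h}. z mod d \<in> S} = (\<lambda>(r, q). r + d * q) ` (S \<times> {0..<h})" (is "?L = ?R")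
  proof (rule set_eqI, rule iffI)
    fix z assume z: "z \<in> ?L"
    have "d * (z div d) \<le> z" using d mult_div_mod_eq[of d z] pos_mod_sign[of d z] by linarith
    then have "d * (z div d) < d * h" using z by auto
    then have "z div d < h" using d by simp
    moreover have "0 \<le> z div d" using z d by (simp add: pos_imp_zdiv_nonneg_iff)
    ultimately show "z \<in> ?R" using z by (intro image_eqI[of _ _ "(z mod d, z div d)"]) auto
  next
    fix z assume "z \<in> ?R"
    then obtain r q where z: "z = r + d * q" "r \<in> S" "0 \<le> q" "q < h" by auto
    then have r: "0 \<le> r" "r < d" using S by auto
    have "d * q + d \<le> d * h" using d z(4) mult_left_mono[of "q + 1" h d] by (simp add: algebra_simps)
    moreover have "0 \<le> d * q" using d z(3) by simp
    ultimately show "z \<in> ?L" using z r by auto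
  qed
  moreover have "inj_on (\<lambda>(r, q). r + d * q) (S \<times> {0..<h})"
  proof (rule inj_onI, clarsimp)
    fix r q r' q' assume *: "r \<in> S" "r' \<in> S" "r + d * q = r' + d * q'"
    then have r: "0 \<le> r" "r < d" "0 \<le> r'" "r' < d" using S by auto
    have "(r + d * q) mod d = (r' + d * q') mod d" "(r + d * q) div d = (r' + d * q') div d" using * by simp_all
    then show "r = r' \<and> q = q'" using r d by simp
  qed
  ultimately have "card {z \<in> {0..<d * h}. z mod d \<in> S} = card (S \<times> {0..<h})" by (simp add: card_image)
  then show ?thesis using h by (simp add: card_cartesian_product)
qed

text \<open>Two distinct indices both occur in the sum. For a repeated index other than
  \<open>s\<close>, one copy is traded for \<open>s\<close>, which has the largest defect. Only the
  double of \<open>s\<close> can exceed the total, and it costs at most twice the total.\<close>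

lemma pair_defect_bound:
  fixes e :: "'a \<Rightarrow> int"
  assumes "finite C" "\<And>c. c \<in> C \<Longrightarrow> 0 \<le> e c" "s \<in> C" "\<And>c. c \<in> C \<Longrightarrow> e c \<le> e s"
    and "c \<in> C" "c' \<in> C"
  shows "e c + e c' \<le> sum e C + (if c = s \<and> c' = s then sum e C else 0)"
proof -
  have pair: "e x + e y \<le> sum e C" if "x \<noteq> y" "x \<in> C" "y \<in> C" for x y
    using sum_mono2[of C "{x, y}" e] that assms(1,2) by simp
  have "e c \<le> sum e C" using member_le_sum[of c C e] assms by auto
  then show ?thesis
    using pair[of c c'] pair[of c s] pair[of s c'] assms(4)[OF assms(5)] assms(4)[OF assms(6)] assms(3,5,6)
      sum_nonneg[of C e] assms(2)
    by (cases "c = c'"; cases "c = s") auto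
qed

text \<open>Here \<open>F c\<close> is the part of \<open>A\<close> in the residue class \<open>c\<close> modulo \<open>d\<close>, and \<open>e c\<close> counts its holes. The bound
  \<open>holes\<close> says that fewer points are missing in total than a single coset has, so \<open>U + U\<close> has at least \<open>u - 1\<close> classes
  outside \<open>U\<close>; these never arise from class \<open>0\<close>, and only one of them can arise as the double of a class that
  contains more than half of the remaining holes.\<close>

theorem freiman_3k_minus_3:
  fixes A :: "int set"
  assumes A: "A \<subseteq> {0..l}" "0 \<in> A" "l \<in> A"
    and gcd: "\<And>d. 1 < d \<Longrightarrow> \<exists>a\<in>A. \<not> d dvd a"
    and l: "2 * int (card A) - 2 \<le> l"
  shows "3 * int (card A) - 3 \<le> int (card (A + A))"
proof (rule ccontr)
  assume "\<not> ?thesis"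
  then have small: "int (card (A + A)) \<le> 3 * int (card A) - 4" by simp
  define k where "k = int (card A)"
  have finA: "finite A" using A finite_subset by blast
  have finAA: "finite (A + A)" using finA by (simp add: finite_set_plus)
  obtain a where "a \<in> A" "\<not> 2 dvd a" using gcd[of 2] by auto
  then have "0 < l" using A by (cases "l = 0") auto
  \<comment> \<open>The endpoints 0 and \<open>l\<close> coincide modulo \<open>l\<close>, so
    \<open>B\<close> represents \<open>A\<close> there with one element fewer.\<close>
  define B where "B = A - {l}"
  have B: "B \<subseteq> {0..<l}" "0 \<in> B" "finite B" using A finA \<open>0 < l\<close> by (auto simp: B_def)
  have cB: "int (card B) = k - 1" using finA A(3) card_Suc_Diff1[of A l] by (auto simp: B_def k_def)
  let ?G = "{0..<l}"
  have fold1: "msum l B B \<subseteq> {z \<in> ?G. z \<in> A + A \<or> z + l \<in> A + A}"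
  proof
    fix z assume "z \<in> msum l B B"
    then obtain x y where xy: "x \<in> B" "y \<in> B" "z = (x + y) mod l" by (rule msumE)
    then have "0 \<le> x" "x < l" "0 \<le> y" "y < l" using B by auto
    moreover have "x + y \<in> A + A" using xy by (intro set_plus_intro) (auto simp: B_def)
    ultimately have "0 \<le> x + y" "x + y < 2 * l" "x + y \<in> A + A" by simp_all
    moreover have "(x + y) mod l = (if x + y < l then x + y else x + y - l)"
      using calculation \<open>0 < l\<close> mod_pos_pos_trivial[of "x + y - l" l] by simp
    ultimately show "z \<in> {z \<in> ?G. z \<in> A + A \<or> z + l \<in> A + A}"
      using xy(3) by simp
  qed
  have fold2: "B \<subseteq> {z \<in> ?G. z \<in> A + A \<and> z + l \<in> A + A}"
  proof
    fix b assume b: "b \<in> B"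
    then show "b \<in> {z \<in> ?G. z \<in> A + A \<and> z + l \<in> A + A}"
      using B(1) set_plus_intro[OF A(2), of b A] set_plus_intro[OF A(3), of b A]
      by (auto simp: B_def add.commute)
  qed
  have "2 * l \<in> A + A" using set_plus_intro[OF A(3) A(3)] by simp
  then have "int (card (msum l B B)) + (k - 1) + 1 \<le> int (card (A + A))"
    using card_fold_le[OF finAA, of l] card_mono[OF finite_int_window fold1] card_mono[OF finite_int_window fold2]
      \<open>0 < l\<close> cB by (simp only: if_True) linarith
  then have mBB: "int (card (msum l B B)) \<le> 2 * k - 4" using small by (simp add: k_def)
  \<comment> \<open>Since 2 k - 4 < 2 k - 2 \<le> l, the set \<open>B\<close> itself is admissible
    for the minimisation.\<close>
  have "msum l B B \<noteq> ?G" using mBB l \<open>0 < l\<close> by (auto simp: k_def split: if_splits)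
  then obtain H where H: "H \<subseteq> ?G" "0 \<in> H" "\<And>x y. x \<in> H \<Longrightarrow> y \<in> H \<Longrightarrow> (x - y) mod l \<in> H" "msum l H B \<noteq> ?G"
    and minimal: "\<And>X. X \<subseteq> ?G \<Longrightarrow> X \<noteq> {} \<Longrightarrow> msum l X B \<noteq> ?G \<Longrightarrow>
      int (card (msum l H B)) - int (card H) \<le> int (card (msum l X B)) - int (card X)"
    using atom_subgroup[OF \<open>0 < l\<close> B(1) B(1)] B(2) by blast
  obtain d where d: "0 < d" "d dvd l" "H = {z \<in> ?G. d dvd z}"
    using mod_subgroup_multiples[OF \<open>0 < l\<close> H(1-3)] by blast
  define h where "h = l div d"
  have lh: "l = d * h" and h: "0 < h" using d \<open>0 < l\<close> by (auto simp: h_def pos_imp_zdiv_pos_iff zdvd_imp_le)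
  define U where "U = (\<lambda>b. b mod d) ` B"
  have U: "U \<subseteq> {0..<d}" "finite U" "0 \<in> U" using d B by (force simp: U_def)+
  define u where "u = int (card U)"
  have coset: "int (card {z \<in> ?G. z mod d \<in> S}) = int (card S) * h" if "S \<subseteq> {0..<d}" for S
    unfolding lh using card_residues_in[OF d(1) _ that, of h] h by simp
  have "H = {z \<in> ?G. z mod d \<in> {0}}" unfolding d(3) by auto
  then have cH: "int (card H) = h" using coset[of "{0}"] d by simp
  have modmod: "z mod l mod d = z mod d" for z using d(2) by (rule mod_mod_cancel)
  have sum_cosets: "msum l {z \<in> ?G. z mod d \<in> S} B = {z \<in> ?G. z mod d \<in> msum d S U}" if S: "S \<subseteq> {0..<d}" for S
  proof (rule set_eqI, rule iffI)
    fix z assume "z \<in> msum l {z \<in> ?G. z mod d \<in> S} B"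
    then obtain x b where xb: "x mod d \<in> S" "b \<in> B" "z = (x + b) mod l" by (auto elim!: msumE)
    then have "(x mod d + b mod d) mod d \<in> msum d S U" by (auto simp: U_def intro!: msumI)
    then show "z \<in> {z \<in> ?G. z mod d \<in> msum d S U}" using xb(3) modmod \<open>0 < l\<close> by (simp add: mod_add_eq)
  next
    fix z assume z: "z \<in> {z \<in> ?G. z mod d \<in> msum d S U}"
    then obtain s b where sb: "s \<in> S" "b \<in> B" "z mod d = (s + b mod d) mod d" by (auto elim!: msumE simp: U_def)
    have "(z - b) mod d = (s + b mod d - b) mod d" using sb(3) by (metis mod_diff_left_eq)
    also have "\<dots> = s mod d"
      by (metis add_diff_cancel_right' mod_add_right_eq mod_diff_left_eq)
    also have "\<dots> = s" using sb(1) S by auto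
    finally have "((z - b) mod l) mod d \<in> S" using sb(1) modmod by simp
    then have "((z - b) mod l + b) mod l \<in> msum l {z \<in> ?G. z mod d \<in> S} B"
      using sb(2) \<open>0 < l\<close> by (intro msumI) auto
    then show "z \<in> msum l {z \<in> ?G. z mod d \<in> S} B" using z by (simp add: mod_simps)
  qed
  have "msum d {0} U = U" using U(1) by (force simp: msum_def set_plus_def image_iff)
  then have HB: "msum l H B = {z \<in> ?G. z mod d \<in> U}"
    using sum_cosets[of "{0}"] \<open>H = {z \<in> ?G. z mod d \<in> {0}}\<close> d(1) by simp
  then have cHB: "int (card (msum l H B)) = u * h" using coset[OF U(1)] by (simp add: u_def)
  have kappa: "u * h - h \<le> int (card (msum l X B)) - int (card X)"
    if "X \<subseteq> ?G" "X \<noteq> {}" "msum l X B \<noteq> ?G" for X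
    using minimal[OF that] cHB cH by simp
  have "B \<noteq> {}" using B(2) by auto
  \<comment> \<open>Testing minimality on \<open>B\<close> gives (u - 1) h \<le> (2 k - 4) - (k - 1)
    = k - 3, and the cosets met by \<open>B\<close> have \<open>u * h\<close> points
    altogether.\<close>
  then have holes: "u * h - (k - 1) \<le> h - 2"
    using kappa[OF B(1) _ \<open>msum l B B \<noteq> ?G\<close>] mBB cB by simp
  \<comment> \<open>The same bound doubled: (2 u - 2) h \<le> 2 k - 6 < l. So Z/d has room for a
    sumset of 2 u - 1 classes.\<close>
  have "(2 * u - 2) * h < d * h" using holes l lh by (simp add: algebra_simps k_def)
  then have du: "2 * u - 1 \<le> d" using h by simp
  have u2: "2 \<le> u"
  proof -
    have "1 < d"
    proof (rule ccontr)
      assume "\<not> 1 < d"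
      then have "d = 1" using d by simp
      then have "{z \<in> ?G. z mod d \<in> U} = ?G" using U(3) by (auto simp: \<open>d = 1\<close>)
      then show False using HB H(4) by simp
    qed
    then obtain a where a: "a \<in> A" "\<not> d dvd a" using gcd by blast
    then have "a mod d \<in> U" using d(2) by (auto simp: U_def B_def)
    moreover have "a mod d \<noteq> 0" using a by (simp add: dvd_eq_mod_eq_0)
    ultimately show ?thesis using U card_mono[of U "{0, a mod d}"] by (simp add: u_def)
  qed
  define V where "V = msum d U U"
  have V: "V \<subseteq> {0..<d}" "finite V" using msum_subset[OF d(1)] d(1) by (simp_all add: V_def)
  have "U \<subseteq> V"
    using msum_mono[of "{0}" U U U d] U(3) \<open>msum d {0} U = U\<close> by (auto simp: V_def)
  \<comment> \<open>Minimality is tested on the union of the cosets met by \<open>B\<close>. If its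
    sum with \<open>B\<close> is everything, then \<open>V\<close> is all of Z/d and
    \<open>du\<close> gives the bound.\<close>
  have cV: "2 * u - 1 \<le> int (card V)"
  proof (cases "msum l {z \<in> ?G. z mod d \<in> U} B = ?G")
    case True
    have "r \<in> V" if "r \<in> {0..<d}" for r
    proof -
      have "d \<le> d * h" using h d mult_left_mono[of 1 h d] by simp
      then have "r < l" using that unfolding lh atLeastLessThan_iff by linarith
      then have "r \<in> ?G" using that by simp
      then have "r \<in> {z \<in> ?G. z mod d \<in> V}" using True sum_cosets[OF U(1)] by (simp only: V_def)
      moreover have "r mod d = r" using that by simp
      ultimately show ?thesis by simp
    qed
    then have "V = {0..<d}" using V by auto
    then show ?thesis using du d by simp
  next
    case False
    have "0 \<in> {z \<in> ?G. z mod d \<in> U}" using U(3) \<open>0 < l\<close> by simp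
    then have ne: "{z \<in> ?G. z mod d \<in> U} \<noteq> {}" by blast
    have "u * h - h \<le> int (card {z \<in> ?G. z mod d \<in> V}) - int (card {z \<in> ?G. z mod d \<in> U})"
      using kappa[OF _ ne False] unfolding sum_cosets[OF U(1)] V_def by blast
    then have "u * h - h \<le> int (card V) * h - u * h"
      unfolding coset[OF V(1)] coset[OF U(1)] u_def .
    then have "(2 * u - 1) * h \<le> int (card V) * h" by (simp add: algebra_simps)
    then show ?thesis using h by simp
  qed
  have "int (card (V - U)) = int (card V) - u"
    using card_Diff_subset[OF U(2) \<open>U \<subseteq> V\<close>] card_mono[OF V(2) \<open>U \<subseteq> V\<close>] by (simp add: u_def of_nat_diff)
  then have "nat (u - 1) \<le> card (V - U)" using cV by simp
  then obtain W where W: "W \<subseteq> V - U" "card W = nat (u - 1)" "finite W"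
    using obtain_subset_with_card_n by blast
  define F where "F c = {b \<in> B. b mod d = c}" for c
  define e where "e c = h - int (card (F c))" for c
  define f where "f = (\<Sum>c\<in>U - {0}. e c)"
  have finF: "finite (F c)" for c using B(3) by (simp add: F_def)
  have F_ne: "F c \<noteq> {}" if "c \<in> U" for c using that by (auto simp: F_def U_def)
  have e_nonneg: "0 \<le> e c" if "c \<in> U" for c
  proof -
    have "F c \<subseteq> {z \<in> ?G. z mod d \<in> {c}}" using B(1) by (auto simp: F_def)
    from card_mono[OF finite_int_window this] show ?thesis
      using coset[of "{c}"] U(1) that by (auto simp: e_def)
  qed
  have "B = (\<Union>c\<in>U. F c)" by (auto simp: F_def U_def)
  then have "card B = (\<Sum>c\<in>U. card (F c))"
    using card_UN_disjoint[OF U(2), of F] finF by (auto simp: F_def)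
  then have sumF: "k - 1 = (\<Sum>c\<in>U. int (card (F c)))" using cB by simp
  have "(\<Sum>c\<in>U. e c) = u * h - (k - 1)" unfolding sumF e_def by (simp add: sum_subtractf u_def)
  then have ef: "e 0 + f = u * h - (k - 1)" using sum.remove[OF U(2,3), of e] by (simp add: f_def)
  have f: "0 \<le> f" "f \<le> h - 2"
  proof -
    show "0 \<le> f" unfolding f_def using e_nonneg by (intro sum_nonneg) auto
    show "f \<le> h - 2" using ef e_nonneg[OF U(3)] holes by simp
  qed
  have pairs: "card (F c) + card (F c') \<le> card (F c + F c') + 1" if "c \<in> U" "c' \<in> U" for c c'
    using that F_ne by (intro card_sumset_ge finF) auto

  define T where "T v = {s \<in> A + A. s mod d = v}" for v
  have finT: "finite (T v)" for v using finAA by (simp add: T_def)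
  have FT: "F c + F c' \<subseteq> T ((c + c') mod d)" for c c'
  proof
    fix z assume "z \<in> F c + F c'"
    then obtain x y where xy: "z = x + y" "x \<in> F c" "y \<in> F c'" by (rule set_plus_elim)
    then have "z mod d = (c + c') mod d" by (auto simp: F_def mod_add_eq)
    moreover have "z \<in> A + A" unfolding xy(1) using xy by (intro set_plus_intro) (auto simp: F_def B_def)
    ultimately show "z \<in> T ((c + c') mod d)" by (simp add: T_def)
  qed
  have "l \<notin> F 0" using B(1) by (auto simp: F_def)
  then have card_insert_F: "card (insert l (F 0)) = card (F 0) + 1" using finF by simp
  \<comment> \<open>Class 0 of \<open>A\<close> contains \<open>l\<close> besides
    \<open>F 0\<close>, so the bound becomes 2 (h - e 0 + 1) - 1.\<close>
  have T0: "2 * (h - e 0) + 1 \<le> int (card (T 0))"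
  proof -
    let ?F = "insert l (F 0)"
    have "card ?F + card ?F \<le> card (?F + ?F) + 1" using finF by (intro card_sumset_ge) auto
    moreover have "?F + ?F \<subseteq> T 0"
    proof
      fix z assume "z \<in> ?F + ?F"
      then obtain x y where xy: "z = x + y" "x \<in> ?F" "y \<in> ?F" by (rule set_plus_elim)
      then have "d dvd x" "d dvd y" "x \<in> A" "y \<in> A" using d(2) A(3) by (auto simp: F_def B_def dvd_eq_mod_eq_0)
      then show "z \<in> T 0" unfolding xy(1) T_def by (auto simp: set_plus_intro)
    qed
    then have "card (?F + ?F) \<le> card (T 0)" using finT by (intro card_mono)
    ultimately show ?thesis using card_insert_F by (simp add: e_def)
  qed
  \<comment> \<open>After division by \<open>d\<close>, class 0 of \<open>A\<close> becomes a subset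
    \<open>?I\<close> of \<open>{0..h}\<close> containing both ends, and class \<open>v\<close>
    becomes \<open>?J\<close>. As e 0 + e v \<le> h - 2, they are dense enough for the bound h +
    |J|, which does not lose the defect of class 0.\<close>
  have TU: "2 * h - e v \<le> int (card (T v))" if v: "v \<in> U - {0}" for v
  proof -
    let ?I = "{i \<in> {0..h}. d * i \<in> A}" and ?J = "{i \<in> {0..h}. v + d * i \<in> B}"
    have v': "0 < v" "v < d" using v U(1) by auto
    have "(\<lambda>i. v + d * i) ` ?J = F v"
    proof (rule set_eqI, rule iffI)
      fix b assume "b \<in> F v"
      then have b: "b \<in> B" "b mod d = v" "0 \<le> b" "b < d * h" using B(1) lh by (auto simp: F_def)
      have eq: "b = v + d * (b div d)" using mult_div_mod_eq[of d b] b(2) by simp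
      then have "d * (b div d) < d * h" using b(4) v'(1) by linarith
      then have "b div d < h" using d(1) by simp
      moreover have "0 \<le> b div d" using b(3) d(1) by (simp add: pos_imp_zdiv_nonneg_iff)
      ultimately show "b \<in> (\<lambda>i. v + d * i) ` ?J" using b(1) eq by (intro image_eqI[of _ _ "b div d"]) auto
    qed (use v' in \<open>auto simp: F_def\<close>)
    moreover have "card ((\<lambda>i. v + d * i) ` ?J) = card ?J" using d by (intro card_image inj_onI) auto
    ultimately have cJ: "int (card ?J) = h - e v" by (simp add: e_def)
    have "(\<lambda>i. d * i) ` ?I = insert l (F 0)"
    proof (rule set_eqI, rule iffI)
      fix b assume "b \<in> insert l (F 0)"
      then have b: "b \<in> A" "d dvd b" "0 \<le> b" "b \<le> d * h" using A B(1) lh d(2) by (auto simp: F_def B_def dvd_eq_mod_eq_0)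
      then obtain i where i: "b = d * i" by blast
      then have "0 \<le> i" "i \<le> h" using b(3,4) d(1) by (auto simp: zero_le_mult_iff)
      then show "b \<in> (\<lambda>i. d * i) ` ?I" using b(1) i by auto
    qed (auto simp: F_def B_def)
    moreover have "card ((\<lambda>i. d * i) ` ?I) = card ?I" using d by (intro card_image inj_onI) auto
    ultimately have cI: "int (card ?I) = h - e 0 + 1" using card_insert_F by (simp add: e_def)
    have "e v \<le> f" unfolding f_def using v U(2) e_nonneg by (intro member_le_sum) auto
    then have "h + 3 \<le> int (card ?I) + int (card ?J)" using cI cJ ef holes by simp
    then have "h + int (card ?J) \<le> int (card (?I + ?J))"
      using A lh h by (intro card_dense_sumset_ge) auto
    moreover have "card ((\<lambda>i. v + d * i) ` (?I + ?J)) = card (?I + ?J)" using d by (intro card_image inj_onI) auto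
    moreover have "card ((\<lambda>i. v + d * i) ` (?I + ?J)) \<le> card (T v)"
    proof (rule card_mono[OF finT], rule image_subsetI)
      fix z assume "z \<in> ?I + ?J"
      then obtain i j where ij: "z = i + j" "i \<in> ?I" "j \<in> ?J" by (rule set_plus_elim)
      then have "d * i + (v + d * j) \<in> A + A" by (intro set_plus_intro) (auto simp: B_def)
      then have "v + d * z \<in> A + A" using ij(1) by (simp add: algebra_simps)
      moreover have "(v + d * z) mod d = v" using v' by simp
      ultimately show "v + d * z \<in> T v" by (simp add: T_def)
    qed
    ultimately show ?thesis using cJ by simp
  qed
  obtain s where s: "s \<in> U - {0}" "\<And>c. c \<in> U - {0} \<Longrightarrow> e c \<le> e s"
  proof -
    have "U - {0} \<noteq> {}" using u2 U card_mono[of "{0}" U] by (auto simp: u_def)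
    moreover have "finite (U - {0})" using U(2) by simp
    ultimately have "Max (e ` (U - {0})) \<in> e ` (U - {0})" by (intro Max_in) auto
    then obtain s where "s \<in> U - {0}" "e s = Max (e ` (U - {0}))" by (metis imageE)
    moreover have "e c \<le> Max (e ` (U - {0}))" if "c \<in> U - {0}" for c using that U(2) by (intro Max_ge) auto
    ultimately show thesis using that by metis
  qed
  define x where "x = (s + s) mod d"
  have TW: "2 * h - 1 - f - (if w = x then f else 0) \<le> int (card (T w))" if w: "w \<in> W" for w
  proof -
    have "w \<in> msum d U U" "w \<notin> U" using w W(1) by (auto simp: V_def)
    then obtain c c' where c: "c \<in> U" "c' \<in> U" "w = (c + c') mod d" by (auto elim!: msumE)
    have "c mod d = c" "c' mod d = c'" using c U(1) by auto
    then have ne: "c \<in> U - {0}" "c' \<in> U - {0}" using c \<open>w \<notin> U\<close> by auto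
    have "e c + e c' \<le> f + (if c = s \<and> c' = s then f else 0)"
      unfolding f_def by (rule pair_defect_bound) (use U(2) e_nonneg s ne in auto)
    moreover have "c = s \<and> c' = s \<Longrightarrow> w = x" using c by (simp add: x_def)
    moreover have "card (F c + F c') \<le> card (T w)" unfolding c(3) by (intro card_mono finT FT)
    ultimately show ?thesis using pairs[OF c(1,2)] f(1) by (auto simp: e_def split: if_splits)
  qed
  have "(\<Sum>v\<in>U \<union> W. card (T v)) = card (\<Union>v\<in>U \<union> W. T v)"
    using U(2) W(3) finT by (intro card_UN_disjoint[symmetric]) (auto simp: T_def)
  also have "\<dots> \<le> card (A + A)" using finAA by (intro card_mono) (auto simp: T_def)
  finally have "(\<Sum>v\<in>U \<union> W. int (card (T v))) \<le> int (card (A + A))" by (simp flip: of_nat_sum)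
  moreover have "(\<Sum>v\<in>U \<union> W. int (card (T v))) = (\<Sum>v\<in>U. int (card (T v))) + (\<Sum>v\<in>W. int (card (T v)))"
    using U(2) W by (intro sum.union_disjoint) auto
  moreover have "(\<Sum>v\<in>U. int (card (T v))) = int (card (T 0)) + (\<Sum>v\<in>U - {0}. int (card (T v)))"
    using U by (intro sum.remove)
  moreover have cU: "int (card (U - {0})) = u - 1" using U(2,3) u2 by (simp add: u_def of_nat_diff)
  have "(\<Sum>v\<in>U - {0}. 2 * h - e v) \<le> (\<Sum>v\<in>U - {0}. int (card (T v)))"
    using TU by (intro sum_mono)
  then have "(u - 1) * (2 * h) - f \<le> (\<Sum>v\<in>U - {0}. int (card (T v)))"
    using cU by (simp add: sum_subtractf f_def)
  moreover have "(\<Sum>w\<in>W. 2 * h - 1 - f - (if w = x then f else 0)) \<le> (\<Sum>w\<in>W. int (card (T w)))"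
    using TW by (intro sum_mono)
  then have "(u - 1) * (2 * h - 1 - f) - f \<le> (\<Sum>w\<in>W. int (card (T w)))"
    using W(2,3) u2 f(1) by (simp add: sum_subtractf sum.delta split: if_splits)
  ultimately have "2 * (h - e 0) + 1 + ((u - 1) * (2 * h) - f) + ((u - 1) * (2 * h - 1 - f) - f) \<le> 3 * k - 4"
    using T0 small by (simp add: k_def)
  \<comment> \<open>Substitute k - 1 = u h - e 0 - f. The product is nonnegative because f \<le> h -
    2.\<close>
  then have "e 0 + (u - 2) * (h - 1 - f) \<le> -1" using ef by (simp add: algebra_simps)
  moreover have "0 \<le> (u - 2) * (h - 1 - f)" using u2 f by simp
  ultimately show False using e_nonneg[OF U(3)] by simp
qed

text \<open>Subtract the minimum and divide by the gcd of the differences. The contrapositive of the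
  preceding theorem bounds the resulting diameter by 2 |A| - 3, which is the density that the fold
  and the interval results require.\<close>

theorem freiman_3k_minus_4:
  fixes A :: "int set"
  assumes fin: "finite A" and small: "int (card (A + A)) \<le> 3 * int (card A) - 4"
  obtains a d N u :: int and B where "0 < d" "A = (\<lambda>x. a + d * x) ` B" "card B = card A"
    "B \<subseteq> {0..N}" "0 \<in> B" "N \<in> B" "N \<le> int (card (A + A)) - int (card A)"
    "{u..<u + (2 * int (card A) - 1)} \<subseteq> B + B"
proof -
  have ne: "A \<noteq> {}" using small by auto
  have "card A + card A \<le> card (A + A) + 1" using fin ne by (intro card_sumset_ge)
  then have card3: "3 \<le> card A" using small by simp
  define a where "a = Min A"
  define d where "d = Gcd ((\<lambda>x. x - a) ` A)"
  define f where "f x = (x - a) div d" for x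
  define B where "B = f ` A"
  have a: "a \<in> A" "\<And>x. x \<in> A \<Longrightarrow> a \<le> x" using fin ne by (auto simp: a_def)
  have dvd: "d dvd x - a" if "x \<in> A" for x unfolding d_def using that by (intro Gcd_dvd) auto
  have "d \<noteq> 0"
  proof
    assume "d = 0"
    then have "A \<subseteq> {a}" using dvd by auto
    then have "card A \<le> 1" using card_mono[of "{a}" A] by simp
    then show False using card3 by simp
  qed
  moreover have "0 \<le> d" by (simp add: d_def)
  ultimately have d: "0 < d" by simp
  have f: "a + d * f x = x" if "x \<in> A" for x using dvd[OF that] by (simp add: f_def)
  have AB: "A = (\<lambda>x. a + d * x) ` B" using f by (force simp: B_def image_iff)
  have cB: "card B = card A" unfolding AB using d by (subst card_image) (auto intro: inj_onI)
  define N where "N = f (Max A)"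
  have "Max A \<in> A" using fin ne by simp
  have B: "B \<subseteq> {0..N}" "0 \<in> B" "N \<in> B"
  proof -
    have "f x \<le> N" if "x \<in> A" for x unfolding N_def f_def using that fin d by (intro zdiv_mono1) auto
    moreover have "0 \<le> f x" if "x \<in> A" for x using a(2)[OF that] d by (simp add: f_def pos_imp_zdiv_nonneg_iff)
    ultimately show "B \<subseteq> {0..N}" by (auto simp: B_def)
    show "0 \<in> B" unfolding B_def using a(1) by (intro image_eqI[of _ _ a]) (auto simp: f_def)
    show "N \<in> B" unfolding B_def N_def using \<open>Max A \<in> A\<close> by simp
  qed
  have "A + A = (\<lambda>z. 2 * a + d * z) ` (B + B)"
  proof (rule set_eqI, rule iffI)
    fix z assume "z \<in> A + A"
    then obtain x y where "z = x + y" "x \<in> A" "y \<in> A" by (rule set_plus_elim)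
    then show "z \<in> (\<lambda>z. 2 * a + d * z) ` (B + B)"
      using f[of x] f[of y] by (intro image_eqI[of _ _ "f x + f y"]) (auto simp: B_def algebra_simps intro: set_plus_intro)
  next
    fix z assume "z \<in> (\<lambda>z. 2 * a + d * z) ` (B + B)"
    then obtain w where w: "z = 2 * a + d * w" "w \<in> B + B" by blast
    from w(2) obtain x y where "w = x + y" "x \<in> B" "y \<in> B" by (rule set_plus_elim)
    then have "z = (a + d * x) + (a + d * y)" "a + d * x \<in> A" "a + d * y \<in> A"
      using w(1) by (auto simp: AB algebra_simps)
    then show "z \<in> A + A" by (metis set_plus_intro)
  qed
  then have cBB: "card (A + A) = card (B + B)" using d by (simp add: card_image inj_on_def)
  have gcd: "\<exists>b\<in>B. \<not> e dvd b" if "1 < e" for e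
  proof (rule ccontr)
    assume "\<not> ?thesis"
    then have "e dvd f x" if "x \<in> A" for x using that by (auto simp: B_def)
    then have "d * e dvd x - a" if "x \<in> A" for x using f[OF that] that by (metis add_diff_cancel_left' dvd_refl mult_dvd_mono)
    then have "d * e dvd d" unfolding d_def by (intro Gcd_greatest) auto
    then have "d * e \<le> d * 1" using d by (simp add: zdvd_imp_le)
    then show False using d that by simp
  qed
  have "\<not> 3 * int (card B) - 3 \<le> int (card (B + B))" using small cB cBB by simp
  then have N: "N + 3 \<le> int (card B) + int (card B)" using freiman_3k_minus_3[OF B gcd] by linarith
  have "N + int (card B) \<le> int (card (B + B))" using B(1) B N by (intro card_dense_sumset_ge)
  moreover obtain u where "{u..<u + (int (card B) + int (card B) - 1)} \<subseteq> B + B"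
    using dense_sumset_interval[OF B(1) B N] small cB cBB by auto
  ultimately show thesis using that[OF d AB cB B, of u] cB cBB by simp
qed

section \<open>Fourier analysis and half circles\<close>

text \<open>The sign of the sine away from multiples of pi. Through \<open>frac\<close>, the value 1
  means lying in a half-open half circle.\<close>

definition square_wave :: "real \<Rightarrow> real" where
  "square_wave y = (if frac (y / (2 * pi)) < 1 / 2 then 1 else - 1)"

lemma has_integral_sin:
  fixes a b :: real
  assumes "a \<le> b"
  shows "(sin has_integral (cos a - cos b)) {a..b}"
proof -
  have "(sin has_integral (- cos b - - cos a)) {a..b}"
    using assms by (intro fundamental_theorem_of_calculus)
      (auto intro!: derivative_eq_intros simp flip: has_real_derivative_iff_has_vector_derivative)
  then show ?thesis by simp
qed

lemma has_integral_sign_change_sin: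
  fixes g :: "real \<Rightarrow> real"
  assumes c: "0 \<le> c" "c \<le> pi"
    and g: "\<And>\<phi>. 0 \<le> \<phi> \<Longrightarrow> \<phi> < c \<Longrightarrow> g \<phi> = s" "\<And>\<phi>. c < \<phi> \<Longrightarrow> \<phi> < pi \<Longrightarrow> g \<phi> = - s"
  shows "((\<lambda>\<phi>. g \<phi> * sin \<phi>) has_integral (- 2 * s * cos c)) {0..pi}"
proof -
  have "((\<lambda>\<phi>. s * sin \<phi>) has_integral s * (cos 0 - cos c)) {0..c}"
    using c by (intro has_integral_mult_right has_integral_sin)
  then have 1: "((\<lambda>\<phi>. g \<phi> * sin \<phi>) has_integral s * (cos 0 - cos c)) {0..c}"
    by (rule has_integral_spike_finite[of "{c}", rotated 2]) (use g in auto)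
  have "((\<lambda>\<phi>. - s * sin \<phi>) has_integral - s * (cos c - cos pi)) {c..pi}"
    using c by (intro has_integral_mult_right has_integral_sin)
  then have 2: "((\<lambda>\<phi>. g \<phi> * sin \<phi>) has_integral - s * (cos c - cos pi)) {c..pi}"
    by (rule has_integral_spike_finite[of "{c, pi}", rotated 2]) (use g in auto)
  have "s * (cos 0 - cos c) + - s * (cos c - cos pi) = - 2 * s * cos c" by (simp add: algebra_simps)
  then show ?thesis using has_integral_combine[OF c 1 2] by simp
qed

text \<open>The shifted wave changes sign at most once on the half period. The identity presents the
  cosine as an average of half-circle signs with the nonnegative weight sin / 2.\<close>

lemma has_integral_square_wave:
  "((\<lambda>\<phi>. square_wave (y + \<phi>) * sin \<phi>) has_integral (2 * cos y)) {0..pi}"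
proof -
  define z where "z = 2 * pi * frac (y / (2 * pi))"
  have z: "0 \<le> z" "z < 2 * pi" using frac_lt_1[of "y / (2 * pi)"] by (auto simp: z_def)
  have y: "y = z + 2 * pi * of_int \<lfloor>y / (2 * pi)\<rfloor>" by (simp add: z_def frac_def field_simps)
  have cos: "cos y = cos z" using y by (metis cos_int_2pin cos_add sin_int_2pin mult.right_neutral mult_zero_right diff_zero)
  have wave: "square_wave (y + \<phi>) = (if z + \<phi> < pi then 1 else if z + \<phi> < 2 * pi then - 1 else 1)"
    if "0 \<le> \<phi>" "\<phi> < pi" for \<phi>
  proof -
    have eq: "(y + \<phi>) / (2 * pi) = (z + \<phi>) / (2 * pi) + of_int \<lfloor>y / (2 * pi)\<rfloor>"
      by (subst y) (simp add: field_simps)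
    have fr: "frac ((y + \<phi>) / (2 * pi)) = frac ((z + \<phi>) / (2 * pi))" unfolding eq by simp
    show ?thesis
    proof (cases "z + \<phi> < 2 * pi")
      case True
      then have "frac ((z + \<phi>) / (2 * pi)) = (z + \<phi>) / (2 * pi)" using z that by (subst frac_eq) (simp add: field_simps)
      moreover have "(z + \<phi>) / (2 * pi) < 1 / 2 \<longleftrightarrow> z + \<phi> < pi" by (subst pos_divide_less_eq) auto
      ultimately show ?thesis using True unfolding square_wave_def fr by simp
    next
      case False
      have "(z + \<phi>) / (2 * pi) = (z + \<phi> - 2 * pi) / (2 * pi) + 1" by (simp add: field_simps)
      then have "frac ((z + \<phi>) / (2 * pi)) = frac ((z + \<phi> - 2 * pi) / (2 * pi))"
        by (simp only: frac_1_eq)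
      also have "\<dots> = (z + \<phi> - 2 * pi) / (2 * pi)" using False z that by (subst frac_eq) (simp add: field_simps)
      finally have "frac ((y + \<phi>) / (2 * pi)) = (z + \<phi> - 2 * pi) / (2 * pi)" unfolding fr .
      moreover have "(z + \<phi> - 2 * pi) / (2 * pi) < 1 / 2" using z that by (subst pos_divide_less_eq) auto
      moreover have "\<not> z + \<phi> < pi" using False pi_gt_zero by linarith
      ultimately show ?thesis using False unfolding square_wave_def by simp
    qed
  qed
  show ?thesis
  proof (cases "z < pi")
    case True
    have "((\<lambda>\<phi>. square_wave (y + \<phi>) * sin \<phi>) has_integral (- 2 * 1 * cos (pi - z))) {0..pi}"
      by (rule has_integral_sign_change_sin) (use True z wave in auto)
    then show ?thesis using cos by (simp add: cos_diff)
  next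
    case False
    have "((\<lambda>\<phi>. square_wave (y + \<phi>) * sin \<phi>) has_integral (- 2 * (- 1) * cos (2 * pi - z))) {0..pi}"
      by (rule has_integral_sign_change_sin) (use False z wave in auto)
    then show ?thesis using cos by (simp add: cos_diff)
  qed
qed

text \<open>Rotated onto the positive real axis, the sum becomes a sum of cosines, hence a weighted
  average over rotations of the points inside a half circle minus those outside. It is at most the
  value at a fullest half circle, which exists because the counts are bounded integers.\<close>

lemma sum_cis_le_half_circle:
  fixes x :: "'a \<Rightarrow> real"
  assumes fin: "finite A"
  obtains \<phi> where "cmod (\<Sum>a\<in>A. cis (x a)) \<le> 2 * real (card {a \<in> A. frac ((x a + \<phi>) / (2 * pi)) < 1 / 2}) - real (card A)"
proof -
  define n where "n \<phi> = card {a \<in> A. frac ((x a + \<phi>) / (2 * pi)) < 1 / 2}" for \<phi>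
  have "n \<phi> \<le> card A" for \<phi> unfolding n_def using fin by (intro card_mono) auto
  then obtain \<phi>0 where \<phi>0: "\<And>\<phi>. n \<phi> \<le> n \<phi>0"
    using ex_has_greatest_nat[of "\<lambda>_. True" 0 n "Suc (card A)"] by (auto simp: less_Suc_eq_le)
  define S where "S = (\<Sum>a\<in>A. cis (x a))"
  define \<theta> where "\<theta> = Arg S"
  define K where "K = 2 * real (n \<phi>0) - real (card A)"
  have "cmod S * cis \<theta> = S" unfolding \<theta>_def using rcis_cmod_Arg[of S] by (simp add: rcis_def)
  then have "S * cis (- \<theta>) = cmod S" by (metis cis_mult cis_zero add.right_inverse mult.assoc mult.right_neutral)
  moreover have "S * cis (- \<theta>) = (\<Sum>a\<in>A. cis (x a - \<theta>))" by (simp add: S_def sum_distrib_right cis_mult)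
  ultimately have "complex_of_real (cmod S) = (\<Sum>a\<in>A. cis (x a - \<theta>))" by simp
  then have "Re (complex_of_real (cmod S)) = Re (\<Sum>a\<in>A. cis (x a - \<theta>))" by (rule arg_cong)
  then have norm: "cmod S = (\<Sum>a\<in>A. cos (x a - \<theta>))" by simp
  have "((\<lambda>\<phi>. \<Sum>a\<in>A. square_wave (x a - \<theta> + \<phi>) * sin \<phi>) has_integral (\<Sum>a\<in>A. 2 * cos (x a - \<theta>))) {0..pi}"
    using fin by (intro has_integral_sum has_integral_square_wave)
  then have I: "((\<lambda>\<phi>. (\<Sum>a\<in>A. square_wave (x a - \<theta> + \<phi>)) * sin \<phi>) has_integral 2 * cmod S) {0..pi}"
    by (simp add: norm sum_distrib_left sum_distrib_right)
  have "((\<lambda>\<phi>. K * sin \<phi>) has_integral K * (cos 0 - cos pi)) {0..pi}"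
    by (intro has_integral_mult_right has_integral_sin) simp
  then have J: "((\<lambda>\<phi>. K * sin \<phi>) has_integral K * 2) {0..pi}" by simp
  have wave: "(\<Sum>a\<in>A. square_wave (x a - \<theta> + \<phi>)) \<le> K" for \<phi>
  proof -
    have "(\<Sum>a\<in>A. square_wave (x a - \<theta> + \<phi>))
        = (\<Sum>a\<in>A. 2 * (if frac ((x a + (\<phi> - \<theta>)) / (2 * pi)) < 1 / 2 then 1 else 0) - 1)"
      by (intro sum.cong) (auto simp: square_wave_def algebra_simps)
    also have "\<dots> = 2 * real (n (\<phi> - \<theta>)) - real (card A)"
      using fin by (simp add: sum_subtractf n_def sum.If_cases Int_def flip: sum_distrib_left)
    also have "\<dots> \<le> K" using \<phi>0 by (simp add: K_def)
    finally show ?thesis .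
  qed
  have "2 * cmod S \<le> K * 2"
    by (rule has_integral_le[OF I J]) (intro mult_right_mono wave, simp add: sin_ge_zero)
  then show thesis using that[of \<phi>0] by (simp add: S_def K_def n_def)
qed

section \<open>Exponential sums modulo p and the large Fourier coefficient\<close>

definition expsum :: "int \<Rightarrow> int set \<Rightarrow> int \<Rightarrow> complex" where
  "expsum p A k = (\<Sum>a\<in>A. cis (2 * pi * of_int (k * a) / of_int p))"

lemma sum_cis_orthogonal:
  fixes p m :: int
  assumes "0 < p"
  shows "(\<Sum>k\<in>{0..<p}. cis (2 * pi * of_int (k * m) / of_int p)) = (if p dvd m then of_int p else 0)"
proof -
  define w where "w = cis (2 * pi * of_int m / of_int p)"
  have "(\<Sum>k\<in>{0..<p}. cis (2 * pi * of_int (k * m) / of_int p)) = (\<Sum>i<nat p. w ^ i)"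
  proof (rule sum.reindex_bij_witness[of _ int nat])
    fix k assume k: "k \<in> {0..<p}"
    then have "w ^ nat k = cis (of_int k * (2 * pi * of_int m / of_int p))" by (simp add: w_def Complex.DeMoivre)
    then show "w ^ nat k = cis (2 * pi * of_int (k * m) / of_int p)" by (simp add: mult_ac)
  qed (use assms in auto)
  also have "\<dots> = (if p dvd m then of_int p else 0)"
  proof (cases "p dvd m")
    case True
    then obtain q where "m = p * q" by blast
    then have "2 * pi * of_int m / of_int p = 2 * pi * real_of_int q" using assms by simp
    then have "w = 1" unfolding w_def by (simp only: cis_multiple_2pi Ints_of_int)
    then show ?thesis using True assms by simp
  next
    case False
    have "w \<noteq> 1"
    proof
      assume "w = 1"
      then have "cos (2 * pi * of_int m / of_int p) = 1" by (metis w_def cis.sel(1) one_complex.sel(1))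
      then obtain q :: int where "2 * pi * of_int m / of_int p = of_int q * 2 * pi" by (auto simp: cos_one_2pi_int)
      then have "real_of_int m = of_int (q * p)" using assms by (simp add: field_simps)
      then have "m = q * p" by linarith
      then show False using False by simp
    qed
    have "w ^ nat p = cis (of_int p * (2 * pi * of_int m / of_int p))" using assms by (simp add: w_def Complex.DeMoivre)
    also have "\<dots> = cis (2 * pi * of_int m)" using assms by simp
    finally have "w ^ nat p = 1" by simp
    then show ?thesis using False \<open>w \<noteq> 1\<close> by (simp add: geometric_sum)
  qed
  finally show ?thesis .
qed

lemma expsum_parseval:
  assumes "0 < p" "A \<subseteq> {0..<p}"
  shows "(\<Sum>k\<in>{0..<p}. (cmod (expsum p A k))\<^sup>2) = of_int p * real (card A)"
proof -
  have fin: "finite A" using assms(2) finite_subset by blast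
  have "(\<Sum>k\<in>{0..<p}. expsum p A k * cnj (expsum p A k))
      = (\<Sum>k\<in>{0..<p}. \<Sum>a\<in>A. \<Sum>b\<in>A. cis (2 * pi * of_int (k * (a - b)) / of_int p))"
    by (simp add: expsum_def sum_product cis_cnj cis_mult right_diff_distrib diff_divide_distrib)
  also have "\<dots> = (\<Sum>a\<in>A. \<Sum>b\<in>A. \<Sum>k\<in>{0..<p}. cis (2 * pi * of_int (k * (a - b)) / of_int p))"
    by (subst sum.swap, rule sum.cong[OF refl], rule sum.swap)
  also have "\<dots> = (\<Sum>a\<in>A. \<Sum>b\<in>A. if b = a then of_int p else 0)"
  proof (intro sum.cong refl)
    fix a b assume "a \<in> A" "b \<in> A"
    then have "a mod p = a" "b mod p = b" using assms(2) by auto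
    then have "p dvd a - b \<longleftrightarrow> b = a" by (metis mod_eq_dvd_iff)
    then show "(\<Sum>k\<in>{0..<p}. cis (2 * pi * of_int (k * (a - b)) / of_int p)) = (if b = a then of_int p else 0)"
      using sum_cis_orthogonal[OF assms(1), of "a - b"] by simp
  qed
  also have "\<dots> = complex_of_real (of_int p * real (card A))" using fin by (simp add: sum.delta)
  finally have "(\<Sum>k\<in>{0..<p}. complex_of_real ((cmod (expsum p A k))\<^sup>2)) = complex_of_real (of_int p * real (card A))"
    by (simp only: complex_norm_square)
  then show ?thesis by (metis (no_types) of_real_eq_iff of_real_sum)
qed

text \<open>By orthogonality in \<open>k\<close>, the left side counts triples (a, b, s) with s
  congruent to a + b; each pair has exactly one such s in the sumset.\<close>

lemma expsum_sumset_count: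
  assumes "0 < p" "A \<subseteq> {0..<p}"
  shows "(\<Sum>k\<in>{0..<p}. expsum p A k * expsum p A k * cnj (expsum p (msum p A A) k)) = of_int p * (of_nat (card A))\<^sup>2"
proof -
  let ?S = "msum p A A"
  let ?c = "\<lambda>k m. cis (2 * pi * of_int (k * m) / of_int p)"
  have fin: "finite A" "finite ?S" using assms finite_subset by auto
  have "(\<Sum>k\<in>{0..<p}. expsum p A k * expsum p A k * cnj (expsum p ?S k))
      = (\<Sum>k\<in>{0..<p}. \<Sum>s\<in>?S. \<Sum>a\<in>A. \<Sum>b\<in>A. ?c k (b + a - s))"
    by (simp add: expsum_def sum_product cis_cnj cis_mult sum_distrib_left sum_distrib_right
        ring_distribs add_divide_distrib diff_divide_distrib)
  also have "\<dots> = (\<Sum>s\<in>?S. \<Sum>k\<in>{0..<p}. \<Sum>a\<in>A. \<Sum>b\<in>A. ?c k (b + a - s))" by (rule sum.swap)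
  also have "\<dots> = (\<Sum>s\<in>?S. \<Sum>a\<in>A. \<Sum>k\<in>{0..<p}. \<Sum>b\<in>A. ?c k (b + a - s))"
    by (rule sum.cong[OF refl], rule sum.swap)
  also have "\<dots> = (\<Sum>s\<in>?S. \<Sum>a\<in>A. \<Sum>b\<in>A. \<Sum>k\<in>{0..<p}. ?c k (b + a - s))"
    by (rule sum.cong[OF refl], rule sum.cong[OF refl], rule sum.swap)
  also have "\<dots> = (\<Sum>s\<in>?S. \<Sum>a\<in>A. \<Sum>b\<in>A. if s = (b + a) mod p then of_int p else 0)"
  proof (intro sum.cong refl)
    fix a b s assume "s \<in> ?S"
    then have "s \<in> {0..<p}" using msum_subset[OF assms(1)] by blast
    then have "s mod p = s" by simp
    then have "p dvd b + a - s \<longleftrightarrow> s = (b + a) mod p" by (metis mod_eq_dvd_iff)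
    then show "(\<Sum>k\<in>{0..<p}. ?c k (b + a - s)) = (if s = (b + a) mod p then of_int p else 0)"
      using sum_cis_orthogonal[OF assms(1), of "b + a - s"] by simp
  qed
  also have "\<dots> = (\<Sum>a\<in>A. \<Sum>s\<in>?S. \<Sum>b\<in>A. if s = (b + a) mod p then of_int p else 0)"
    by (rule sum.swap)
  also have "\<dots> = (\<Sum>a\<in>A. \<Sum>b\<in>A. \<Sum>s\<in>?S. if s = (b + a) mod p then of_int p else 0)"
    by (rule sum.cong[OF refl], rule sum.swap)
  also have "\<dots> = (\<Sum>a\<in>A. \<Sum>b\<in>A. of_int p)"
    using fin by (intro sum.cong refl) (simp add: sum.delta msumI)
  also have "\<dots> = of_int p * (of_nat (card A))\<^sup>2" by (simp add: power2_eq_square)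
  finally show ?thesis .
qed

text \<open>The term k = 0 of the triple count is n^2 s, so the others add up to n^2 (p - s). They
  are bounded by \<open>M\<close> times Cauchy-Schwarz, with Parseval stripped of its zero
  terms.\<close>

lemma large_fourier_coefficient:
  assumes p: "0 < p" and A: "A \<subseteq> {0..<p}"
    and M: "\<And>k. k \<in> {1..<p} \<Longrightarrow> cmod (expsum p A k) \<le> M" "0 \<le> M"
    and n: "n = real (card A)" and s: "s = real (card (msum p A A))"
  shows "(n\<^sup>2 * (of_int p - s))\<^sup>2 \<le> M\<^sup>2 * (n * (of_int p - n)) * (s * (of_int p - s))"
proof -
  let ?S = "msum p A A"
  let ?E = "expsum p A" and ?F = "expsum p ?S"
  have split: "sum g {0..<p} = g 0 + sum g {1..<p}" for g :: "int \<Rightarrow> 'b::comm_monoid_add"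
  proof -
    have "{0..<p} - {0} = {1..<p}" by auto
    then show ?thesis using sum.remove[of "{0..<p}" 0 g] p by simp
  qed
  have E0: "?E 0 = of_real n" "?F 0 = of_real s" by (auto simp: expsum_def n s)
  have pE: "(\<Sum>k\<in>{1..<p}. (cmod (?E k))\<^sup>2) = n * (of_int p - n)"
    using expsum_parseval[OF p A] split[of "\<lambda>k. (cmod (?E k))\<^sup>2"] E0
    by (simp add: n algebra_simps power2_eq_square)
  have pF: "(\<Sum>k\<in>{1..<p}. (cmod (?F k))\<^sup>2) = s * (of_int p - s)"
    using expsum_parseval[OF p msum_subset[OF p]] split[of "\<lambda>k. (cmod (?F k))\<^sup>2"] E0
    by (simp add: s algebra_simps power2_eq_square)
  have "complex_of_real (n\<^sup>2 * (of_int p - s)) = (\<Sum>k\<in>{1..<p}. ?E k * ?E k * cnj (?F k))"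
    using expsum_sumset_count[OF p A] split[of "\<lambda>k. ?E k * ?E k * cnj (?F k)"] E0
    by (simp add: n algebra_simps power2_eq_square)
  then have "\<bar>n\<^sup>2 * (of_int p - s)\<bar> = cmod (\<Sum>k\<in>{1..<p}. ?E k * ?E k * cnj (?F k))"
    by (metis norm_of_real)
  also have "\<dots> \<le> (\<Sum>k\<in>{1..<p}. M * (cmod (?E k) * cmod (?F k)))"
    using M by (intro sum_norm_le) (auto simp: norm_mult intro!: mult_right_mono simp flip: mult.assoc)
  also have "\<dots> = M * (\<Sum>k\<in>{1..<p}. cmod (?E k) * cmod (?F k))" by (simp add: sum_distrib_left)
  finally have "\<bar>n\<^sup>2 * (of_int p - s)\<bar>\<^sup>2 \<le> (M * (\<Sum>k\<in>{1..<p}. cmod (?E k) * cmod (?F k)))\<^sup>2"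
    by (intro power_mono) auto
  also have "\<dots> = M\<^sup>2 * (\<Sum>k\<in>{1..<p}. cmod (?E k) * cmod (?F k))\<^sup>2" by (simp add: power_mult_distrib)
  also have "\<dots> \<le> M\<^sup>2 * ((\<Sum>k\<in>{1..<p}. (cmod (?E k))\<^sup>2) * (\<Sum>k\<in>{1..<p}. (cmod (?F k))\<^sup>2))"
    by (intro mult_left_mono Cauchy_Schwarz_ineq_sum) simp
  finally show ?thesis unfolding pE pF by (simp add: mult.assoc)
qed

text \<open>The last identity is 4 times the cubic, in the shape produced by the Fourier bound. The
  fraction 7/50 is a handy rational just above the root, for linear estimates.\<close>

lemma root_bounds:
  fixes \<alpha> :: real
  assumes "4 * \<alpha>^3 + 9 * \<alpha>^2 + 6 * \<alpha> - 1 = 0"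
  shows "0 < \<alpha>" "\<alpha> < 7 / 50" "(1 + 2 * \<alpha>)\<^sup>2 * (5 + 4 * \<alpha>) = 9"
proof -
  have eq: "\<alpha> * (4 * \<alpha>\<^sup>2 + 9 * \<alpha> + 6) = 1" using assms by (simp add: algebra_simps power2_eq_square power3_eq_cube)
  have "4 * \<alpha>\<^sup>2 + 9 * \<alpha> + 6 = (2 * \<alpha> + 9 / 4)\<^sup>2 + 15 / 16" by (simp add: power2_eq_square algebra_simps)
  then have "0 < 4 * \<alpha>\<^sup>2 + 9 * \<alpha> + 6" using zero_le_power2[of "2 * \<alpha> + 9 / 4"] by linarith
  then show pos: "0 < \<alpha>" using eq by (metis zero_less_mult_pos2 zero_less_one)
  show "\<alpha> < 7 / 50"
  proof (rule ccontr)
    assume "\<not> ?thesis"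
    then have "7 / 50 \<le> \<alpha>" by simp
    then have "7 / 50 * (4 * (7 / 50)\<^sup>2 + 9 * (7 / 50) + 6) \<le> \<alpha> * (4 * \<alpha>\<^sup>2 + 9 * \<alpha> + 6)"
      by (intro mult_mono add_mono power_mono) auto
    then show False unfolding eq by (simp add: power2_eq_square)
  qed
  show "(1 + 2 * \<alpha>)\<^sup>2 * (5 + 4 * \<alpha>) = 9"
    using assms by (simp add: algebra_simps power2_eq_square power3_eq_cube)
qed

text \<open>The conclusion is Freiman's condition for the half-circle portion, whose own sumset has
  at most |2A| elements.\<close>

lemma rectifiable_dilate:
  fixes p :: int and \<alpha> :: real
  assumes p: "1 < p" and A: "A \<subseteq> {0..<p}" "A \<noteq> {}"
    and \<alpha>: "4 * \<alpha>^3 + 9 * \<alpha>^2 + 6 * \<alpha> - 1 = 0"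
    and small: "real (card (msum p A A)) \<le> (2 + \<alpha>) * real (card A) - 3"
    and dense: "real (card (msum p A A)) \<le> 3 / 4 * of_int p"
  obtains t c where "t \<in> {1..<p}"
    "card (msum p A A) + 4 \<le> 3 * card {a \<in> A. 2 * ((t * a + c) mod p) < p}"
proof (rule ccontr)
  note witness = that
  assume "\<not> thesis"
  then have no: "3 * card {a \<in> A. 2 * ((t * a + c) mod p) < p} \<le> card (msum p A A) + 3" if "t \<in> {1..<p}" for t c
    using that witness[of t c] by force
  define n where "n = real (card A)"
  define s where "s = real (card (msum p A A))"
  define P where "P = real_of_int p"
  \<comment> \<open>A bound of (s + 3) / 3 for every half circle makes each coefficient at most 2 (s
    + 3) / 3 - n; inserting s + 3 \<le> (2 + \<alpha>) n gives \<open>M\<close>.\<close>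
  define M where "M = (1 + 2 * \<alpha>) * n / 3"
  have fin: "finite A" using A finite_subset by blast
  have n: "0 < n" using A fin by (simp add: n_def card_gt_0_iff)
  have P: "0 < P" using p by (simp add: P_def)
  have M: "cmod (expsum p A k) \<le> M" if k: "k \<in> {1..<p}" for k
  proof -
    obtain \<phi> where \<phi>: "cmod (expsum p A k) \<le>
        2 * real (card {a \<in> A. frac ((2 * pi * of_int (k * a) / of_int p + \<phi>) / (2 * pi)) < 1 / 2}) - n"
      unfolding expsum_def n_def
      using sum_cis_le_half_circle[OF fin, of "\<lambda>a. 2 * pi * of_int (k * a) / of_int p"] by blast
    \<comment> \<open>\<open>w\<close> is the rotation measured in residues. Rounding it down to the
      integer shift \<open>c\<close> moves points back by less than one residue, so none leaves the
      half circle.\<close>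
    define w where "w = \<phi> * P / (2 * pi)"
    define c where "c = \<lfloor>w\<rfloor>"
    have "2 * ((k * a + c) mod p) < p" if a: "frac ((2 * pi * of_int (k * a) / of_int p + \<phi>) / (2 * pi)) < 1 / 2" for a
    proof -
      let ?q = "(k * a + c) div p" and ?m = "(k * a + c) mod p"
      have "0 \<le> ?m" "?m < p" using p by simp_all
      then have m: "0 \<le> real_of_int ?m" "real_of_int ?m + 1 \<le> P" unfolding P_def by linarith+
      have wc: "0 \<le> w - of_int c" "w - of_int c < 1" unfolding c_def by linarith+
      have "real_of_int (k * a + c) = P * of_int ?q + of_int ?m"
        unfolding P_def by (metis mult_div_mod_eq of_int_add of_int_mult)
      then have ka: "real_of_int (k * a) = P * of_int ?q + of_int ?m - of_int c" by simp
      have "(2 * pi * of_int (k * a) / of_int p + \<phi>) / (2 * pi) = (of_int (k * a) + w) / P"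
        using P unfolding w_def P_def by (simp add: field_simps)
      then have eq: "(2 * pi * of_int (k * a) / of_int p + \<phi>) / (2 * pi)
          = (of_int ?m + (w - of_int c)) / P + of_int ?q"
        unfolding ka using P by (simp add: add_divide_distrib diff_divide_distrib)
      have "frac ((of_int ?m + (w - of_int c)) / P) = (of_int ?m + (w - of_int c)) / P"
        using m wc P by (subst frac_eq) (auto simp: field_simps)
      then have "(of_int ?m + (w - of_int c)) / P < 1 / 2" using a unfolding eq by simp
      then have "2 * real_of_int ?m < P" using wc P by (simp add: field_simps)
      then show ?thesis unfolding P_def by linarith
    qed
    then have "card {a \<in> A. frac ((2 * pi * of_int (k * a) / of_int p + \<phi>) / (2 * pi)) < 1 / 2}
        \<le> card {a \<in> A. 2 * ((k * a + c) mod p) < p}"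
      using fin by (intro card_mono) auto
    then have "3 * real (card {a \<in> A. frac ((2 * pi * of_int (k * a) / of_int p + \<phi>) / (2 * pi)) < 1 / 2}) \<le> s + 3"
      using no[OF k, of c] unfolding s_def by linarith
    then have "cmod (expsum p A k) \<le> 2 * (s + 3) / 3 - n" using \<phi> by (simp add: field_simps)
    also have "\<dots> \<le> M" using small by (simp add: M_def n_def s_def field_simps)
    finally show ?thesis .
  qed
  note \<alpha>' = root_bounds[OF \<alpha>]
  have sP: "s \<le> 3 / 4 * P" and ns: "s + 3 \<le> (2 + \<alpha>) * n" using small dense by (auto simp: s_def P_def n_def)
  have "0 \<le> M" using \<alpha>' n by (simp add: M_def)
  have fourier: "(n\<^sup>2 * (P - s))\<^sup>2 \<le> M\<^sup>2 * (n * (P - n)) * (s * (P - s))"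
    unfolding P_def using large_fourier_coefficient[OF _ A(1) M \<open>0 \<le> M\<close> n_def s_def] p by simp
  have MM: "(5 + 4 * \<alpha>) * M\<^sup>2 = n\<^sup>2"
  proof -
    have "(5 + 4 * \<alpha>) * M\<^sup>2 = ((1 + 2 * \<alpha>)\<^sup>2 * (5 + 4 * \<alpha>)) * n\<^sup>2 / 9" by (simp add: M_def power_mult_distrib power_divide)
    then show ?thesis unfolding \<alpha>'(3) by simp
  qed
  have pos: "0 < n ^ 3 * (P - s)" using n sP P by simp
  have "(n ^ 3 * (P - s)) * ((5 + 4 * \<alpha>) * (n * (P - s))) = (5 + 4 * \<alpha>) * (n\<^sup>2 * (P - s))\<^sup>2"
    by (simp add: power2_eq_square power3_eq_cube)
  also have "\<dots> \<le> (5 + 4 * \<alpha>) * (M\<^sup>2 * (n * (P - n)) * (s * (P - s)))"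
    using fourier \<alpha>' by (intro mult_left_mono) auto
  also have "\<dots> = ((5 + 4 * \<alpha>) * M\<^sup>2) * (n * (P - n)) * (s * (P - s))" by simp
  also have "\<dots> = (n ^ 3 * (P - s)) * ((P - n) * s)"
    unfolding MM by (simp add: power2_eq_square power3_eq_cube)
  finally have "(5 + 4 * \<alpha>) * (n * (P - s)) \<le> (P - n) * s" using pos by (simp only: mult_le_cancel_left_pos)
  also have "\<dots> = P * s - n * s" by (simp add: algebra_simps)
  also have "\<dots> < P * ((2 + \<alpha>) * n) - n * s" using P ns by (intro diff_strict_right_mono mult_strict_left_mono) auto
  finally have "n * ((5 + 4 * \<alpha>) * (P - s)) < n * (P * (2 + \<alpha>) - s)" by (simp add: algebra_simps)
  then have "(5 + 4 * \<alpha>) * (P - s) < P * (2 + \<alpha>) - s" using n by simp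
  \<comment> \<open>The coefficients of \<open>P\<close> and \<open>s\<close> are 3 + 3 \<alpha> and
    4 + 4 \<alpha>, so 1 + \<alpha> cancels and exactly the constant 3/4 remains.\<close>
  then have "(1 + \<alpha>) * (3 * P) < (1 + \<alpha>) * (4 * s)" by (simp add: algebra_simps)
  then show False using \<alpha>'(1) sP by simp
qed

section \<open>Freiman's theorem modulo a prime\<close>

text \<open>Since d \<le> d N \<le> w < p, the difference \<open>d\<close> is invertible modulo
  \<open>p\<close>, and the normalisation found in the integers can be carried out in Z/p.\<close>

lemma freiman_3k_minus_4_coprime:
  fixes p :: int and R :: "int set"
  assumes p: "prime p" and R: "R \<subseteq> {v..v + w}" "w < p"
    and small: "int (card (R + R)) \<le> 3 * int (card R) - 4"
  obtains a d N u :: int and B where "coprime d p" "R = (\<lambda>x. a + d * x) ` B" "card B = card R"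
    "B \<subseteq> {0..N}" "0 \<in> B" "N \<in> B" "N \<le> int (card (R + R)) - int (card R)"
    "{u..<u + (2 * int (card R) - 1)} \<subseteq> B + B"
proof -
  have fin: "finite R" using R(1) finite_subset by blast
  obtain a d N u :: int and B where F: "0 < d" "R = (\<lambda>x. a + d * x) ` B" "card B = card R"
    "B \<subseteq> {0..N}" "0 \<in> B" "N \<in> B" "N \<le> int (card (R + R)) - int (card R)"
    "{u..<u + (2 * int (card R) - 1)} \<subseteq> B + B"
    by (rule freiman_3k_minus_4[OF fin small])
  have "R \<noteq> {}" using small by auto
  then have "card R + card R \<le> card (R + R) + 1" using fin by (intro card_sumset_ge)
  then have "3 \<le> card B" using small F(3) by simp
  moreover have "card B \<le> card {0..N}" using F(4) by (intro card_mono) auto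
  ultimately have "1 \<le> N" by simp
  have "a \<in> R" "a + d * N \<in> R" using F(2,5,6) by force+
  then have "a \<in> {v..v + w}" "a + d * N \<in> {v..v + w}" using R(1) by blast+
  then have "d * N \<le> w" by simp
  moreover have "d * 1 \<le> d * N" using F(1) \<open>1 \<le> N\<close> by (intro mult_left_mono) auto
  ultimately have "d < p" using R(2) by linarith
  then have "\<not> p dvd d" using F(1) zdvd_not_zless by blast
  then have "coprime d p" using p by (metis coprime_commute prime_imp_coprime)
  then show thesis using that F by blast
qed

section \<open>Passing between Z/p and integer windows\<close>

lemma inj_on_mod_window:
  fixes p v :: int
  assumes "S \<subseteq> {v..<v + p}"
  shows "inj_on (\<lambda>x. x mod p) S"
proof (rule inj_onI)
  fix x y assume xy: "x \<in> S" "y \<in> S" "x mod p = y mod p"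
  then have "x \<in> {v..<v + p}" "y \<in> {v..<v + p}" using assms by auto
  then have "\<bar>x - y\<bar> < p" by auto
  moreover have "p dvd \<bar>x - y\<bar>" using xy by (simp add: mod_eq_dvd_iff)
  ultimately show "x = y" using zdvd_not_zless[of "\<bar>x - y\<bar>" p] by (cases "x = y") simp_all
qed

lemma card_residues_in_window:
  fixes p v :: int
  assumes "0 < p" "T \<subseteq> {0..<p}"
  shows "card {x \<in> {v..<v + p}. x mod p \<in> T} = card T"
proof -
  have im: "(\<lambda>x. x mod p) ` {x \<in> {v..<v + p}. x mod p \<in> T} = T"
  proof (rule set_eqI, rule iffI)
    fix z assume "z \<in> T"
    then have "z mod p = z" using assms(2) by auto
    then have "(v + (z - v) mod p) mod p = z" using mod_add_right_eq[of v "z - v" p] by simp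
    then show "z \<in> (\<lambda>x. x mod p) ` {x \<in> {v..<v + p}. x mod p \<in> T}"
      using assms(1) \<open>z \<in> T\<close> by (intro image_eqI[of _ _ "v + (z - v) mod p"]) auto
  qed auto
  have "inj_on (\<lambda>x. x mod p) {x \<in> {v..<v + p}. x mod p \<in> T}"
    by (rule inj_on_mod_window[of _ v]) auto
  then show ?thesis by (subst (2) im[symmetric]) (rule card_image[symmetric])
qed

lemma msum_mod_image: "msum p ((\<lambda>x. x mod p) ` X) ((\<lambda>x. x mod p) ` Y) = (\<lambda>z. z mod p) ` (X + Y)"
proof (rule set_eqI, rule iffI)
  fix z assume "z \<in> msum p ((\<lambda>x. x mod p) ` X) ((\<lambda>x. x mod p) ` Y)"
  then obtain x y where "x \<in> X" "y \<in> Y" "z = (x mod p + y mod p) mod p" by (auto elim!: msumE)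
  then show "z \<in> (\<lambda>z. z mod p) ` (X + Y)" by (intro image_eqI[of _ _ "x + y"] set_plus_intro) (auto simp: mod_simps)
next
  fix z assume "z \<in> (\<lambda>z. z mod p) ` (X + Y)"
  then obtain x y where xy: "x \<in> X" "y \<in> Y" "z = (x + y) mod p" by (auto elim!: set_plus_elim)
  then have "z = (x mod p + y mod p) mod p" by (simp add: mod_simps)
  then show "z \<in> msum p ((\<lambda>x. x mod p) ` X) ((\<lambda>x. x mod p) ` Y)" using xy by (auto intro!: msumI)
qed

text \<open>All sums lie in a window of 2 w + 1 \<le> p integers, on which reduction is
  injective.\<close>

lemma card_rectified_sumset:
  fixes p v w :: int
  assumes R: "R \<subseteq> {v..v + w}" and w: "2 * w < p"
  shows "card (msum p ((\<lambda>x. x mod p) ` R) ((\<lambda>x. x mod p) ` R)) = card (R + R)"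
proof -
  have "R + R \<subseteq> {2 * v..<2 * v + p}"
  proof
    fix z assume "z \<in> R + R"
    then obtain x y where "z = x + y" "x \<in> R" "y \<in> R" by (rule set_plus_elim)
    then have "z = x + y" "x \<in> {v..v + w}" "y \<in> {v..v + w}" using R by auto
    then show "z \<in> {2 * v..<2 * v + p}" using w by auto
  qed
  then show ?thesis unfolding msum_mod_image by (intro card_image inj_on_mod_window)
qed

text \<open>The complement \<open>C\<close> of the sumset avoids the long interval of \<open>A1 + A1\<close>, so \<open>C - A1\<close> wraps around \<open>p\<close>
  nowhere, and it misses \<open>B\<close>. As it is small it contains a long interval, whose complement confines \<open>B\<close>.\<close>

lemma confine_to_interval:
  fixes p N u :: int and A1 B :: "int set"
  assumes p: "0 < p" and B: "B \<subseteq> {0..<p}"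
    and A1: "A1 \<subseteq> {0..N}" "0 \<in> A1" "N \<in> A1" "(\<lambda>x. x mod p) ` A1 \<subseteq> B"
    and J: "{u..<u + (2 * int (card A1) - 1)} \<subseteq> A1 + A1"
    and s: "s = int (card (msum p B B))"
    and N: "N \<le> s - int (card A1)" and big: "s + 4 \<le> 3 * int (card A1)"
    and sp: "4 * s \<le> 3 * p" and sum: "2 * s + 4 \<le> p + int (card B) + int (card A1)"
  obtains v where "B \<subseteq> (\<lambda>x. x mod p) ` {v..v + (s - int (card A1))}"
proof -
  define n1 where "n1 = int (card A1)"
  define S where "S = msum p B B"
  have S: "S \<subseteq> {0..<p}" using msum_subset[OF p] by (simp add: S_def)
  have finA1: "finite A1" using A1(1) finite_subset by blast
  have finB: "finite B" using B finite_subset by blast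
  have s0: "0 \<le> s" by (simp add: s)
  have "card ((\<lambda>x. x mod p) ` A1) \<le> card B" using A1(4) finB by (intro card_mono)
  moreover have "card ((\<lambda>x. x mod p) ` A1) = card A1"
    by (intro card_image inj_on_mod_window[of _ 0]) (use A1(1) N sp big s0 in auto)
  ultimately have n1B: "n1 \<le> int (card B)" by (simp add: n1_def)
  \<comment> \<open>The missing residues are lifted to the window starting at \<open>u\<close>,
    where the long interval of \<open>A1 + A1\<close> starts. So the first 2 n1 - 1 points of the
    window contain no element of \<open>C\<close>.\<close>
  define C where "C = {c \<in> {u..<u + p}. c mod p \<in> {0..<p} - S}"
  have "card ({0..<p} - S) = card {0..<p} - card S" using S by (intro card_Diff_subset) (auto intro: finite_subset)
  moreover have "card S \<le> card {0..<p}" using S by (intro card_mono) auto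
  ultimately have cC: "int (card C) = p - s"
    using card_residues_in_window[OF p, of "{0..<p} - S" u] p unfolding C_def s S_def[symmetric] by (simp add: of_nat_diff)
  have finC: "finite C" unfolding C_def by (rule finite_int_window)
  have "C \<noteq> {}" using cC sp s0 p by auto
  define c0 where "c0 = Min C"
  define K where "K = Max C - c0"
  have c0: "c0 \<in> C" "\<And>c. c \<in> C \<Longrightarrow> c0 \<le> c" and K: "c0 + K \<in> C" "\<And>c. c \<in> C \<Longrightarrow> c \<le> c0 + K"
    using finC \<open>C \<noteq> {}\<close> by (auto simp: c0_def K_def)
  have low: "u + (2 * n1 - 1) \<le> c" if "c \<in> C" for c
  proof (rule ccontr)
    assume "\<not> ?thesis"
    then have "c \<in> A1 + A1" using J that by (auto simp: C_def n1_def)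
    then have "c mod p \<in> msum p ((\<lambda>x. x mod p) ` A1) ((\<lambda>x. x mod p) ` A1)" unfolding msum_mod_image by simp
    then have "c mod p \<in> S" using msum_mono[OF A1(4) A1(4)] by (auto simp: S_def)
    then show False using that by (simp add: C_def)
  qed
  have Kp: "K \<le> p - 2 * n1" using low[OF c0(1)] K(1) by (auto simp: C_def)
  define X where "X = (\<lambda>c. c - c0) ` C"
  define Y where "Y = (\<lambda>a. N - a) ` A1"
  have X: "X \<subseteq> {0..K}" "0 \<in> X" "K \<in> X" using c0 K by (force simp: X_def image_iff)+
  have Y: "Y \<subseteq> {0..N}" "0 \<in> Y" "N \<in> Y" using A1(1,2,3) by (force simp: Y_def image_iff)+
  have cX: "int (card X) = p - s" unfolding X_def cC[symmetric] by (subst card_image) (auto intro: inj_onI)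
  have cY: "int (card Y) = n1" unfolding Y_def n1_def by (subst card_image) (auto intro: inj_onI)
  \<comment> \<open>If c - a were in \<open>B\<close>, then c = (c - a) + a would be in B +
    B.\<close>
  have avoid: "(z + c0 - N) mod p \<notin> B" if "z \<in> X + Y" for z
  proof
    assume zB: "(z + c0 - N) mod p \<in> B"
    from that obtain x y where "z = x + y" "x \<in> X" "y \<in> Y" by (rule set_plus_elim)
    then obtain c a where ca: "c \<in> C" "a \<in> A1" "z + c0 - N = c - a" by (auto simp: X_def Y_def)
    have "a mod p \<in> B" using ca(2) A1(4) by auto
    then have "((c - a) mod p + a mod p) mod p \<in> S" using zB ca(3) by (auto simp: S_def intro!: msumI)
    then show False using ca(1) by (simp add: C_def mod_simps)
  qed
  \<comment> \<open>Here K + N \<le> (p - 2 n1) + (s - n1) \<le> p - 4 by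
    \<open>big\<close>.\<close>
  have "X + Y \<subseteq> {0..<p}"
  proof
    fix z assume "z \<in> X + Y"
    then obtain x y where "z = x + y" "x \<in> X" "y \<in> Y" by (rule set_plus_elim)
    then have "z = x + y" "x \<in> {0..K}" "y \<in> {0..N}" using X Y by auto
    then show "z \<in> {0..<p}" using Kp N big by (auto simp: n1_def)
  qed
  then have "inj_on (\<lambda>z. (1 * z + (c0 - N)) mod p) (X + Y)"
    using inj_on_affine_mod[of 1 p] by (rule inj_on_subset[rotated]) simp
  then have "card (X + Y) = card ((\<lambda>z. (1 * z + (c0 - N)) mod p) ` (X + Y))" by (simp add: card_image)
  also have "\<dots> \<le> card ({0..<p} - B)"
    using avoid p by (intro card_mono) (auto simp: algebra_simps)
  also have "\<dots> = card {0..<p} - card B" using B finB by (intro card_Diff_subset)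
  finally have cXY: "int (card (X + Y)) \<le> p - int (card B)"
    using card_mono[OF _ B] p by (simp add: of_nat_diff)
  \<comment> \<open>The longer set goes first, because the interval theorem wants it to contain both
    ends of the ambient interval. Given \<open>cXY\<close>, its smallness condition follows from
    \<open>big\<close> and \<open>n1B\<close> in one case and reduces to \<open>sum\<close> in the
    other.\<close>
  obtain v where v: "{v..<v + (p - s + n1 - 1)} \<subseteq> X + Y"
  proof (cases "N \<le> K")
    case True
    then have "Y \<subseteq> {0..K}" using Y by auto
    moreover have "K + 3 \<le> int (card X) + int (card Y)" using cX cY Kp big by (simp add: n1_def)
    moreover have "int (card (X + Y)) \<le> int (card X) + 2 * int (card Y) - 4"
      using cX cY cXY big n1B by (simp add: n1_def)
    ultimately show thesis using dense_sumset_interval[OF X(1) _ X(2,3), of Y] that cX cY by (auto simp: algebra_simps)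
  next
    case False
    then have "X \<subseteq> {0..N}" using X by auto
    moreover have "N + 3 \<le> int (card Y) + int (card X)" using cX cY N sp big unfolding n1_def by linarith
    moreover have "int (card (Y + X)) \<le> int (card Y) + 2 * int (card X) - 4"
      using cX cY cXY sum by (simp add: n1_def add.commute)
    ultimately show thesis using dense_sumset_interval[OF Y(1) _ Y(2,3), of X] that cX cY by (auto simp: algebra_simps)
  qed
  define v' where "v' = v + c0 - N"
  have "b \<in> (\<lambda>x. x mod p) ` {v' + (p - s + n1 - 1)..v' + (p - s + n1 - 1) + (s - n1)}" if b: "b \<in> B" for b
  proof -
    define x where "x = v' + (b - v') mod p"
    have "x mod p = b mod p" unfolding x_def by (simp add: mod_simps)
    then have xb: "x mod p = b" using b B by auto
    have x: "v' \<le> x" "x < v' + p" using p by (auto simp: x_def)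
    have "v' + (p - s + n1 - 1) \<le> x"
    proof (rule ccontr)
      assume "\<not> ?thesis"
      then have "x - c0 + N \<in> X + Y" using v x(1) by (auto simp: v'_def)
      then show False using avoid[of "x - c0 + N"] xb b by simp
    qed
    then show ?thesis using x xb by (intro image_eqI[of _ _ x]) auto
  qed
  then have "B \<subseteq> (\<lambda>x. x mod p) ` {v' + (p - s + n1 - 1)..v' + (p - s + n1 - 1) + (s - n1)}" by blast
  then show thesis using that unfolding n1_def by blast
qed

theorem freiman_mod_prime:
  fixes p :: int and A :: "int set" and \<alpha> :: real
  assumes p: "prime p" and A: "A \<subseteq> {0..<p}" "A \<noteq> {}"
    and \<alpha>: "4 * \<alpha>^3 + 9 * \<alpha>^2 + 6 * \<alpha> - 1 = 0"
    and small: "real (card (msum p A A)) \<le> (2 + \<alpha>) * real (card A) - 3"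
    and dense: "real (card (msum p A A)) \<le> 3 / 4 * of_int p"
  obtains g a u where "\<not> p dvd g"
    "A \<subseteq> (\<lambda>i. (a + i * g) mod p) ` {0..int (card (msum p A A)) - int (card A)}"
    "(\<lambda>i. (u + i * g) mod p) ` {0..<2 * int (card A) - 1} \<subseteq> msum p A A"
    "2 * int (card A) - 1 \<le> p"
proof -
  define s where "s = int (card (msum p A A))"
  define n where "n = int (card A)"
  have p1: "1 < p" using p prime_gt_1_int by blast
  have finA: "finite A" using A finite_subset by blast
  obtain t c where t: "t \<in> {1..<p}"
    and half: "card (msum p A A) + 4 \<le> 3 * card {a \<in> A. 2 * ((t * a + c) mod p) < p}"
    using rectifiable_dilate[OF p1 A \<alpha> small dense] by blast
  have "\<not> p dvd t" using t zdvd_not_zless by auto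
  then have cop_t: "coprime t p" using p by (metis coprime_commute prime_imp_coprime)
  define A' where "A' = {a \<in> A. 2 * ((t * a + c) mod p) < p}"
  define R where "R = (\<lambda>x. (t * x + c) mod p) ` A'"
  define n1 where "n1 = int (card R)"
  have A': "A' \<subseteq> A" by (auto simp: A'_def)
  have cR: "card R = card A'" unfolding R_def using A' A(1) by (intro card_affine_mod cop_t) auto
  have big: "s + 4 \<le> 3 * n1" using half cR by (simp add: s_def n1_def A'_def)
  have Rw: "R \<subseteq> {0..0 + (p - 1) div 2}"
  proof
    fix z assume z: "z \<in> R"
    then have "2 * z < p" by (auto simp: R_def A'_def)
    moreover have "0 \<le> z" using z p1 by (auto simp: R_def)
    ultimately show "z \<in> {0..0 + (p - 1) div 2}" by auto
  qed
  have w: "2 * ((p - 1) div 2) < p" "(p - 1) div 2 < p" using p1 by auto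
  have "(\<lambda>x. x mod p) ` R = R" by (force simp: R_def image_iff)
  then have "card (R + R) = card (msum p R R)" using card_rectified_sumset[OF Rw w(1)] by simp
  also have "\<dots> = card ((\<lambda>x. (t * x + (c + c)) mod p) ` msum p A' A')" unfolding R_def msum_affine ..
  also have "\<dots> \<le> card (msum p A' A')" using p1 by (intro card_image_le) simp
  also have "\<dots> \<le> card (msum p A A)" using p1 A' by (intro card_mono msum_mono) auto
  finally have RR: "int (card (R + R)) \<le> s" by (simp add: s_def)
  have smallR: "int (card (R + R)) \<le> 3 * int (card R) - 4" using RR big by (simp add: n1_def)
  obtain a d N u :: int and A1 where F: "coprime d p" "R = (\<lambda>x. a + d * x) ` A1" "card A1 = card R"
    "A1 \<subseteq> {0..N}" "0 \<in> A1" "N \<in> A1" "N \<le> int (card (R + R)) - int (card R)"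
    "{u..<u + (2 * int (card R) - 1)} \<subseteq> A1 + A1"
    by (rule freiman_3k_minus_4_coprime[OF p Rw w(2) smallR])
  obtain d' where d': "[d * d' = 1] (mod p)" using cong_solve_coprime_int[OF F(1)] by blast
  \<comment> \<open>The map x \<mapsto> t1 x + c1 is the rectifying dilation followed by the inverse
    of b \<mapsto> a + d b; modulo \<open>p\<close> it carries the crowded portion of
    \<open>A\<close> to \<open>A1\<close>.\<close>
  define t1 where "t1 = d' * t"
  define c1 where "c1 = d' * (c - a)"
  define B where "B = (\<lambda>x. (t1 * x + c1) mod p) ` A"
  have "coprime d' p" using d' by (metis coprime_iff_invertible_int mult.commute)
  then have cop: "coprime t1 p" using cop_t by (simp add: t1_def)
  have B: "B \<subseteq> {0..<p}" using p1 by (auto simp: B_def)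
  have cB: "card B = card A" unfolding B_def using A(1) by (intro card_affine_mod cop)
  have "card (msum p B B) = card (msum p A A)"
    unfolding B_def msum_affine using p1 by (intro card_affine_mod cop msum_subset) simp
  then have sB: "s = int (card (msum p B B))" by (simp add: s_def)
  have A1B: "(\<lambda>x. x mod p) ` A1 \<subseteq> B"
  proof (rule image_subsetI)
    fix b assume "b \<in> A1"
    then have "a + d * b \<in> R" using F(2) by auto
    then obtain x where x: "x \<in> A" "a + d * b = (t * x + c) mod p" using A' by (auto simp: R_def)
    have "[t1 * x + c1 = d' * ((t * x + c) - a)] (mod p)" by (simp add: t1_def c1_def algebra_simps)
    also have "[d' * ((t * x + c) - a) = d' * ((a + d * b) - a)] (mod p)"
      unfolding x(2) by (intro cong_mult cong_diff cong_refl) (simp add: cong_def)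
    also have "[d' * ((a + d * b) - a) = b] (mod p)" using cong_mult[OF d' cong_refl[of b]] by (simp add: algebra_simps)
    finally have "b mod p = (t1 * x + c1) mod p" by (simp add: cong_def)
    then show "b mod p \<in> B" unfolding B_def using x(1) by (rule image_eqI)
  qed
  have "card A' \<le> card A" using A' finA by (intro card_mono)
  then have n1n: "n1 \<le> n" by (simp add: n1_def n_def cR)
  have "(2 + \<alpha>) * real (card A) \<le> (2 + 7 / 50) * real (card A)"
    using root_bounds(2)[OF \<alpha>] by (intro mult_right_mono) auto
  then have ns: "50 * s + 150 \<le> 107 * n" using small unfolding s_def n_def by (simp add: field_simps)
  have sp: "4 * s \<le> 3 * p" using dense unfolding s_def by linarith
  have s0: "0 \<le> s" by (simp add: s_def)
  \<comment> \<open>The lower bounds for p, n and n1 add up to about 2.134 s + 2.74, which reaches 2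
    s + 4 only from s = 10 on. Below that they are rounded up to integers, and each s is
    checked.\<close>
  have sum: "2 * s + 4 \<le> p + n + n1"
  proof (cases "10 \<le> s")
    case True
    then show ?thesis using ns sp big by linarith
  next
    case False
    then have "s = 0 \<or> s = 1 \<or> s = 2 \<or> s = 3 \<or> s = 4 \<or> s = 5 \<or> s = 6 \<or> s = 7 \<or> s = 8 \<or> s = 9"
      using s0 by presburger
    moreover have "(4 * s + 2) div 3 \<le> p" using sp by linarith
    moreover have "(s + 6) div 3 \<le> n1" using big by linarith
    moreover have "(50 * s + 256) div 107 \<le> n" using ns by linarith
    ultimately show ?thesis by (elim disjE) simp_all
  qed
  obtain v where v: "B \<subseteq> (\<lambda>x. x mod p) ` {v..v + (s - n1)}"
    using confine_to_interval[OF _ B F(4,5,6) A1B _ sB] F(3,7,8) RR big sp sum p1 cB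
    by (auto simp: n1_def n_def)
  define B' where "B' = {x \<in> {v..v + (s - n1)}. x mod p \<in> B}"
  have B': "B' \<subseteq> {v..v + (s - n1)}" "(\<lambda>x. x mod p) ` B' = B" using v by (auto simp: B'_def)
  \<comment> \<open>From n1 \<ge> (s + 4) / 3 and s \<le> 3 p / 4 one gets 2 (s - n1) \<le> (4 s -
    8) / 3 < p, so all of \<open>B\<close> can be rectified.\<close>
  have w': "2 * (s - n1) < p" "s - n1 < p" using sp big s0 by simp_all
  have "inj_on (\<lambda>x. x mod p) B'" by (rule inj_on_mod_window[of _ v]) (use B'(1) w'(2) in auto)
  then have cB': "card B' = card A" using B'(2) cB by (metis card_image)
  have sB': "int (card (B' + B')) = s" using card_rectified_sumset[OF B'(1) w'(1)] B'(2) sB by simp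
  have smallB': "int (card (B' + B')) \<le> 3 * int (card B') - 4" using sB' cB' big n1n by (simp add: n_def)
  obtain a2 d2 N2 u2 :: int and B2 where G: "coprime d2 p" "B' = (\<lambda>x. a2 + d2 * x) ` B2" "card B2 = card B'"
    "B2 \<subseteq> {0..N2}" "0 \<in> B2" "N2 \<in> B2" "N2 \<le> int (card (B' + B')) - int (card B')"
    "{u2..<u2 + (2 * int (card B') - 1)} \<subseteq> B2 + B2"
    by (rule freiman_3k_minus_4_coprime[OF p B'(1) w'(2) smallB'])
  obtain t2 where t2: "[t1 * t2 = 1] (mod p)" using cong_solve_coprime_int[OF cop] by blast
  define g where "g = t2 * d2"
  define a3 where "a3 = t2 * (a2 - c1)"
  have "coprime t2 p" using t2 by (metis coprime_iff_invertible_int mult.commute)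
  then have "coprime g p" using G(1) by (simp add: g_def)
  then have g: "\<not> p dvd g" using p1 by (metis coprime_common_divisor dvd_refl not_prime_unit p)
  \<comment> \<open>Undoing x \<mapsto> t1 x + c1 by the inverse \<open>t2\<close> turns the
    progression a2 + d2 i into a3 + i g. Both progressions arise from it, hence the common
    difference \<open>g\<close>.\<close>
  have pull: "[x = a3 + i * g] (mod p)" if "(t1 * x + c1) mod p = (a2 + d2 * i) mod p" for x i
  proof -
    have "[t2 * (t1 * x + c1 - c1) = t2 * (a2 + d2 * i - c1)] (mod p)"
      using that by (intro cong_mult cong_diff cong_refl) (simp add: cong_def)
    moreover have "[t2 * (t1 * x + c1 - c1) = x] (mod p)"
      using cong_mult[OF t2 cong_refl[of x]] by (simp add: algebra_simps)
    ultimately show ?thesis by (simp add: g_def a3_def algebra_simps cong_def)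
  qed
  have cover: "x \<in> (\<lambda>i. (a3 + i * g) mod p) ` {0..s - n}" if x: "x \<in> A" for x
  proof -
    have "(t1 * x + c1) mod p \<in> (\<lambda>x. x mod p) ` B'" unfolding B'(2) using x by (simp add: B_def)
    then obtain y where y: "(t1 * x + c1) mod p = y mod p" "y \<in> B'" by (rule imageE)
    from y(2) obtain i where i: "y = a2 + d2 * i" "i \<in> B2" unfolding G(2) by (rule imageE)
    have "[x = a3 + i * g] (mod p)" using pull y(1) unfolding i(1) by blast
    moreover have "x mod p = x" using x A(1) by auto
    ultimately have "x = (a3 + i * g) mod p" unfolding cong_def by (simp only:)
    moreover have "i \<in> {0..s - n}" using i(2) G(4,7) sB' cB' by (auto simp: n_def)
    ultimately show ?thesis by (rule image_eqI)
  qed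
  have inside: "(2 * a3 + u2 * g + i * g) mod p \<in> msum p A A" if i: "i \<in> {0..<2 * n - 1}" for i
  proof -
    have "u2 + i \<in> B2 + B2" using G(8) i cB' by (auto simp: n_def)
    then obtain j j' where j: "u2 + i = j + j'" "j \<in> B2" "j' \<in> B2" by (rule set_plus_elim)
    have pre: "\<exists>x\<in>A. [x = a3 + j * g] (mod p)" if "j \<in> B2" for j
    proof -
      have "(a2 + d2 * j) mod p \<in> B" unfolding B'(2)[symmetric] G(2) using that by (intro imageI)
      then obtain x where x: "(a2 + d2 * j) mod p = (t1 * x + c1) mod p" "x \<in> A" unfolding B_def by (rule imageE)
      show ?thesis using pull[OF x(1)[symmetric]] x(2) by (rule bexI)
    qed
    obtain x where x: "x \<in> A" "[x = a3 + j * g] (mod p)" using pre[OF j(2)] by (rule bexE)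
    obtain y where y: "y \<in> A" "[y = a3 + j' * g] (mod p)" using pre[OF j(3)] by (rule bexE)
    have "[x + y = (a3 + j * g) + (a3 + j' * g)] (mod p)" using x(2) y(2) by (rule cong_add)
    moreover have "(a3 + j * g) + (a3 + j' * g) = 2 * a3 + (u2 + i) * g" unfolding j(1) by (simp add: algebra_simps)
    moreover have "2 * a3 + (u2 + i) * g = 2 * a3 + u2 * g + i * g" by (simp add: algebra_simps)
    ultimately have "(x + y) mod p = (2 * a3 + u2 * g + i * g) mod p" unfolding cong_def by (simp only:)
    then show ?thesis using msumI[OF x(1) y(1), of p] by (simp only:)
  qed
  \<comment> \<open>This keeps the terms of the inner progression distinct modulo
    \<open>p\<close>.\<close>
  have len: "2 * n - 1 \<le> p"
  proof -
    have "finite B'" using B'(1) finite_subset by blast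
    moreover have "B' \<noteq> {}" using B'(2) A(2) by (auto simp: B_def)
    ultimately have "card B' + card B' \<le> card (B' + B') + 1" by (intro card_sumset_ge)
    then show ?thesis using sB' cB' sp p1 s0 by (simp add: n_def)
  qed
  show thesis
  proof (rule that[OF g])
    show "A \<subseteq> (\<lambda>i. (a3 + i * g) mod p) ` {0..int (card (msum p A A)) - int (card A)}"
      using cover unfolding s_def n_def by (intro subsetI)
    show "(\<lambda>i. (2 * a3 + u2 * g + i * g) mod p) ` {0..<2 * int (card A) - 1} \<subseteq> msum p A A"
      using inside unfolding n_def by (intro image_subsetI)
    show "2 * int (card A) - 1 \<le> p" using len unfolding n_def .
  qed
qed

section \<open>Transfer to residues of type nat\<close>

lemma int_image_sumset_mod: "int ` sumset_mod p A = msum (int p) (int ` A) (int ` A)"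
proof (rule set_eqI, rule iffI)
  fix z assume "z \<in> int ` sumset_mod p A"
  then obtain x y where "x \<in> A" "y \<in> A" "z = (int x + int y) mod int p"
    by (auto simp: sumset_mod_def zmod_int)
  then show "z \<in> msum (int p) (int ` A) (int ` A)" by (auto intro!: msumI)
next
  fix z assume "z \<in> msum (int p) (int ` A) (int ` A)"
  then obtain x y where xy: "x \<in> A" "y \<in> A" "z = (int x + int y) mod int p" by (auto elim!: msumE)
  then have "z = int ((x + y) mod p)" by (simp add: zmod_int)
  then show "z \<in> int ` sumset_mod p A" using xy by (auto simp: sumset_mod_def)
qed

lemma int_image_ap_mod:
  assumes "0 < p"
  shows "int ` ap_mod p (nat (a mod int p)) (nat (g mod int p)) k = (\<lambda>i. (a + i * g) mod int p) ` {0..<int k}"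
proof -
  have step: "int ((nat (a mod int p) + i * nat (g mod int p)) mod p) = (a + int i * g) mod int p" for i
  proof -
    have "int ((nat (a mod int p) + i * nat (g mod int p)) mod p) = (a mod int p + int i * (g mod int p)) mod int p"
      using assms by (simp add: zmod_int)
    then show ?thesis by (metis mod_add_left_eq mod_add_right_eq mod_mult_right_eq)
  qed
  have "ap_mod p (nat (a mod int p)) (nat (g mod int p)) k
      = (\<lambda>i. (nat (a mod int p) + i * nat (g mod int p)) mod p) ` {0..<k}"
    by (auto simp: ap_mod_def)
  then have "int ` ap_mod p (nat (a mod int p)) (nat (g mod int p)) k = (\<lambda>i. (a + int i * g) mod int p) ` {0..<k}"
    by (simp only: image_image step)
  also have "\<dots> = (\<lambda>i. (a + i * g) mod int p) ` (int ` {0..<k})" by (simp only: image_image)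
  finally show ?thesis by (simp only: image_int_atLeastLessThan of_nat_0)
qed

lemma card_ap_mod:
  assumes "prime p" "g mod p \<noteq> 0" "k \<le> p"
  shows "card (ap_mod p a g k) = k"
proof -
  have "inj_on (\<lambda>i. (a + i * g) mod p) {0..<k}"
  proof (rule linorder_inj_onI')
    fix i j assume ij: "i \<in> {0..<k}" "j \<in> {0..<k}" "i < j"
    show "(a + i * g) mod p \<noteq> (a + j * g) mod p"
    proof
      assume "(a + i * g) mod p = (a + j * g) mod p"
      then have "p dvd (a + j * g) - (a + i * g)" using ij(3) by (intro mod_eq_dvd_iff_nat[THEN iffD1]) auto
      then have "p dvd (j - i) * g" by (simp add: diff_mult_distrib)
      then have "p dvd j - i" using assms(1,2) by (auto simp: prime_dvd_mult_iff)
      then show False using ij assms(3) by (auto dest!: dvd_imp_le)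
    qed
  qed
  moreover have "ap_mod p a g k = (\<lambda>i. (a + i * g) mod p) ` {0..<k}" by (auto simp: ap_mod_def)
  ultimately show ?thesis by (simp add: card_image)
qed

theorem theorem1p3:
  fixes p :: nat and A :: "nat set" and \<alpha> :: real
  assumes "prime p"
    and "A \<subseteq> {0..<p}" and "A \<noteq> {}"
    and "4 * \<alpha>^3 + 9 * \<alpha>^2 + 6 * \<alpha> - 1 = 0"
    and "real (card (sumset_mod p A)) \<le> (2 + \<alpha>) * real (card A) - 3"
    and "real (card (sumset_mod p A)) \<le> 3 / 4 * real p"
  shows "\<exists>g PA P2A. is_ap_mod p g PA \<and> is_ap_mod p g P2A \<and>
           A \<subseteq> PA \<and>
           int (card PA) \<le> int (card A) + (int (card (sumset_mod p A)) - 2 * int (card A)) + 1 \<and>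
           P2A \<subseteq> sumset_mod p A \<and>
           int (card P2A) \<ge> 2 * int (card A) - 1"
proof -
  let ?p = "int p" and ?A = "int ` A"
  have p: "prime ?p" "0 < p" using assms(1) prime_gt_0_nat by auto
  have cA: "card ?A = card A" by (simp add: card_image)
  have cS: "card (msum ?p ?A ?A) = card (sumset_mod p A)"
    unfolding int_image_sumset_mod[symmetric] by (simp add: card_image)
  have A: "?A \<subseteq> {0..<?p}" "?A \<noteq> {}" using assms(2,3) by auto
  obtain g a u where g: "\<not> ?p dvd g"
    and PA: "?A \<subseteq> (\<lambda>i. (a + i * g) mod ?p) ` {0..int (card (msum ?p ?A ?A)) - int (card ?A)}"
    and P2A: "(\<lambda>i. (u + i * g) mod ?p) ` {0..<2 * int (card ?A) - 1} \<subseteq> msum ?p ?A ?A"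
    and len: "2 * int (card ?A) - 1 \<le> ?p"
    by (rule freiman_mod_prime[OF p(1) A assms(4)]) (use assms(5,6) in \<open>auto simp: cA cS\<close>)
  define G where "G = nat (g mod ?p)"
  \<comment> \<open>With r = |2A| - 2 |A| this is |A| + r + 1.\<close>
  define k where "k = nat (int (card (sumset_mod p A)) - int (card A) + 1)"
  define k' where "k' = 2 * card A - 1"
  have "card A \<noteq> 0" using assms(2,3) finite_subset by fastforce
  then have k': "int k' = 2 * int (card A) - 1" "1 \<le> k'" "k' \<le> p" using len cA by (auto simp: k'_def)
  have "0 \<le> int (card (msum ?p ?A ?A)) - int (card ?A)" using PA A(2) by (cases "0 \<le> int (card (msum ?p ?A ?A)) - int (card ?A)") auto
  then have k: "int k = int (card (sumset_mod p A)) - int (card A) + 1" "1 \<le> k" using cA cS by (auto simp: k_def)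
  \<comment> \<open>As \<open>A\<close> is nonempty, k \<le> |2A|, which is at most 3 p / 4.\<close>
  have "k \<le> p"
    using k(1) assms(6) \<open>card A \<noteq> 0\<close> by linarith
  have G: "G mod p \<noteq> 0"
  proof -
    have "g mod ?p \<noteq> 0" using g by (simp add: dvd_eq_mod_eq_0)
    moreover have "0 \<le> g mod ?p" "g mod ?p < ?p" using p by auto
    ultimately have "0 < G" "G < p" by (auto simp: G_def)
    then show ?thesis by simp
  qed
  have "int ` A \<subseteq> int ` ap_mod p (nat (a mod ?p)) G k"
    unfolding G_def int_image_ap_mod[OF p(2)] using PA k(1) cA cS
    by (simp add: atLeastLessThanPlusOne_atLeastAtMost_int)
  then have subA: "A \<subseteq> ap_mod p (nat (a mod ?p)) G k" by (simp add: inj_image_subset_iff)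
  have "int ` ap_mod p (nat (u mod ?p)) G k' \<subseteq> int ` sumset_mod p A"
    unfolding G_def int_image_ap_mod[OF p(2)] int_image_sumset_mod using P2A k'(1) cA by simp
  then have sub2A: "ap_mod p (nat (u mod ?p)) G k' \<subseteq> sumset_mod p A" by (simp add: inj_image_subset_iff)
  have "nat (x mod ?p) < p" for x using p by (simp add: nat_less_iff)
  then have "is_ap_mod p G (ap_mod p (nat (a mod ?p)) G k)" "is_ap_mod p G (ap_mod p (nat (u mod ?p)) G k')"
    using G k(2) \<open>k \<le> p\<close> k' unfolding is_ap_mod_def by blast+
  moreover have "card (ap_mod p (nat (a mod ?p)) G k) = k" "card (ap_mod p (nat (u mod ?p)) G k') = k'"
    using card_ap_mod[OF assms(1) G] \<open>k \<le> p\<close> k'(3) by auto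
  ultimately show ?thesis using subA sub2A k(1) k'(1)
    by (intro exI[of _ G] exI[of _ "ap_mod p (nat (a mod ?p)) G k"] exI[of _ "ap_mod p (nat (u mod ?p)) G k'"]) auto
qed

end
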